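(* Let $T$ be an ergodic $\mathbb{R}^d$-action or an ergodic $\mathbb{Z}^d$-action. Then there exist unique, at most countable, concise sets $\mathcal{NE}_T\subseteq\mathbb{G}_d$ and $\mathcal{NW}_T\subseteq\mathbb{G}_d$ such that, for $L\in\mathbb{G}_d$, $L\in\mathcal{E}_T^c$ if and only if $L$ is subordinate to $\mathcal{NE}_T$, and $L\in\mathcal{W}_T^c$ if and only if $L$ is subordinate to $\mathcal{NW}_T$.
   Context: All actions are free measurable measure preserving actions on a Lebesgue probability space $(X,\mu)$. An action is ergodic (weak mixing) if the only invariant $L^2$ functions ($L^2$ eigenfunctions) are constants. Write $\mathbb{G}_{e,d}$ ($0\le e\le d$) for the set of $e$-dimensional linear subspaces of $\mathbb{R}^d$ and $\mathbb{G}_d=\bigcup_{e=0}^d\mathbb{G}_{e,d}$ (so $\{\vec 0\},\mathbb{R}^d\in\mathbb{G}_d$). A set $\mathcal{L}\subseteq\mathbb{G}_d$ is concise if for all $L,L'\in\mathcal{L}$, $L\subseteq L'$ implies $L=L'$. A subspace $L\in\mathbb{G}_d$ is subordinate to $\mathcal{L}\subseteq\mathbb{G}_d$ if $L\subseteq L'$ for some $L'\in\mathcal{L}$. Directional properties are defined for $L\in\mathbb{G}_{e,d}$ with $1\le e\le d$; $\mathcal{E}_T$ and $\mathcal{W}_T$ denote the sets of those $L$ in whose direction $T$ is ergodic, respectively weak mixing. Complements $\mathcal{E}_T^c,\mathcal{W}_T^c$ are taken in $\mathbb{G}_d$ (so $\{\vec 0\}$ belongs to both complements). For an $\mathbb{R}^d$-action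 $T$: $T$ is ergodic (weak mixing) in the direction $L$ if the $L$-action $\{T^{\vec t}\}_{\vec t\in L}$ is ergodic (weak mixing). For a $\mathbb{Z}^d$-action $T$: let $\widetilde T$ be the unit suspension, i.e. the $\mathbb{R}^d$-action on $(\widetilde X,\tilde\mu)=(X\times[0,1)^d,\mu\times\lambda)$, $\lambda$ Lebesgue measure, given by $\widetilde T^{\vec t}(x,\vec r)=(T^{\lfloor\vec t+\vec r\rfloor}x,\{\vec t+\vec r\})$, with componentwise integer part $\lfloor\cdot\rfloor$ and fractional part $\{\cdot\}$. Let $\mathcal{O}=\{F(x,\vec s)=f(\vec s): f\in L^2([0,1)^d,\lambda)\}$ and $L^2_{\mathcal{O}}(\widetilde X,\tilde\mu)=\mathcal{O}^\perp\subseteq L^2(\widetilde X,\tilde\mu)$. A nonzero $F\in L^2(\widetilde X,\tilde\mu)$ is a direction $L$ eigenfunction of $\widetilde T$ if for some $\vec\ell\in L$, $F(\widetilde T^{\vec t}y)=e^{2\pi i\vec\ell\cdot\vec t}F(y)$ for all $\vec t\in L$ and a.e. $y$, and direction $L$ invariant if this holds with $\vec\ell=\vec 0$. $T$ is ergodic (weak mixing) in the direction $L$ if $\widetilde T$ has no nonzero direction $L$ invariant function (direction $L$ eigenfunction) in $L^2_{\mathcal{O}}(\widetilde X,\tilde\mu)$. *)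

theory Defs
  imports "HOL-Probability.Probability_Measure"
begin

text \<open>
  A Lebesgue space in the sense of Rokhlin: a complete probability space which, after discarding
  null sets, is isomorphic to the completion of a Borel probability measure on the line.  (Atoms
  are not excluded here; an essentially free action of an infinite group excludes them.)
\<close>

definition measure_iso :: "'a measure \<Rightarrow> 'b measure \<Rightarrow> ('a \<Rightarrow> 'b) \<Rightarrow> bool" where
  "measure_iso A B \<phi> \<longleftrightarrow>
     bij_betw \<phi> (space A) (space B) \<and>
     \<phi> \<in> measurable A B \<and>
     inv_into (space A) \<phi> \<in> measurable B A \<and>
     distr A B \<phi> = B"

definition lebesgue_prob_space :: "'a measure \<Rightarrow> bool" where
  "lebesgue_prob_space M \<longleftrightarrow>
     prob_space M \<and> complete_measure M \<and>
     (\<exists>(N :: real measure) X0 Y0 \<phi>.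
        prob_space N \<and> sets N = sets borel \<and>
        X0 \<in> sets M \<and> emeasure M X0 = 1 \<and>
        Y0 \<in> sets (completion N) \<and> emeasure (completion N) Y0 = 1 \<and>
        measure_iso (restrict_space M X0) (restrict_space (completion N) Y0) \<phi>)"

text \<open>
  \<open>L2 M\<close> consists of functions rather than classes; all identities between its members below are
  almost everywhere identities.
\<close>

definition L2 :: "'a measure \<Rightarrow> ('a \<Rightarrow> complex) set" where
  "L2 M = {f. f \<in> borel_measurable M \<and> integrable M (\<lambda>x. (cmod (f x))\<^sup>2)}"

definition ae_constant :: "'a measure \<Rightarrow> ('a \<Rightarrow> complex) \<Rightarrow> bool" where
  "ae_constant M f \<longleftrightarrow> (\<exists>c. AE x in M. f x = c)"

definition mp_action :: "'a measure \<Rightarrow> ('t::ab_group_add \<Rightarrow> 'a \<Rightarrow> 'a) \<Rightarrow> bool" where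
  "mp_action M T \<longleftrightarrow>
     (\<forall>x\<in>space M. T 0 x = x) \<and>
     (\<forall>s t. \<forall>x\<in>space M. T (s + t) x = T s (T t x)) \<and>
     (\<forall>t. T t \<in> measurable M M \<and> distr M M (T t) = M)"

definition free_action :: "'a measure \<Rightarrow> ('t::ab_group_add \<Rightarrow> 'a \<Rightarrow> 'a) \<Rightarrow> bool" where
  "free_action M T \<longleftrightarrow> (AE x in M. \<forall>t. T t x = x \<longrightarrow> t = 0)"

definition zd_action :: "'a measure \<Rightarrow> (int ^ 'n \<Rightarrow> 'a \<Rightarrow> 'a) \<Rightarrow> bool" where
  "zd_action M T \<longleftrightarrow> mp_action M T \<and> free_action M T"

text \<open>
  For a flow, joint measurability is required with respect to the completed product: if \<open>M\<close> is
  complete, the uncompleted product \<sigma>-algebra is too small even for translations of a torus.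
\<close>

definition rd_action :: "'a measure \<Rightarrow> (real ^ 'n \<Rightarrow> 'a \<Rightarrow> 'a) \<Rightarrow> bool" where
  "rd_action M T \<longleftrightarrow> mp_action M T \<and> free_action M T \<and>
     (\<lambda>(t, x). T t x) \<in> measurable (completion (lborel \<Otimes>\<^sub>M M)) M"

definition ergodic_on :: "'a measure \<Rightarrow> ('t \<Rightarrow> 'a \<Rightarrow> 'a) \<Rightarrow> 't set \<Rightarrow> bool" where
  "ergodic_on M T S \<longleftrightarrow>
     (\<forall>f\<in>L2 M. (\<forall>t\<in>S. AE x in M. f (T t x) = f x) \<longrightarrow> ae_constant M f)"

definition eigenfunction_at ::
    "'a measure \<Rightarrow> (real ^ 'n \<Rightarrow> 'a \<Rightarrow> 'a) \<Rightarrow> (real ^ 'n) set \<Rightarrow> real ^ 'n \<Rightarrow> ('a \<Rightarrow> complex) \<Rightarrow> bool" where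
  "eigenfunction_at M T L l F \<longleftrightarrow>
     F \<in> L2 M \<and> \<not> (AE y in M. F y = 0) \<and>
     (\<forall>t\<in>L. AE y in M. F (T t y) = exp (2 * of_real pi * \<i> * of_real (l \<bullet> t)) * F y)"

definition dir_eigenfunction ::
    "'a measure \<Rightarrow> (real ^ 'n \<Rightarrow> 'a \<Rightarrow> 'a) \<Rightarrow> (real ^ 'n) set \<Rightarrow> ('a \<Rightarrow> complex) \<Rightarrow> bool" where
  "dir_eigenfunction M T L F \<longleftrightarrow> (\<exists>l\<in>L. eigenfunction_at M T L l F)"

definition dir_invariant ::
    "'a measure \<Rightarrow> (real ^ 'n \<Rightarrow> 'a \<Rightarrow> 'a) \<Rightarrow> (real ^ 'n) set \<Rightarrow> ('a \<Rightarrow> complex) \<Rightarrow> bool" where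
  "dir_invariant M T L F \<longleftrightarrow> eigenfunction_at M T L 0 F"

definition weak_mixing_on ::
    "'a measure \<Rightarrow> (real ^ 'n \<Rightarrow> 'a \<Rightarrow> 'a) \<Rightarrow> (real ^ 'n) set \<Rightarrow> bool" where
  "weak_mixing_on M T L \<longleftrightarrow> (\<forall>F. dir_eigenfunction M T L F \<longrightarrow> ae_constant M F)"

definition grassmannian :: "nat \<Rightarrow> (real ^ 'n) set set" where
  "grassmannian e = {L. subspace L \<and> dim L = e}"

definition grassmannians :: "(real ^ 'n) set set" where
  "grassmannians = (\<Union>e\<in>{0..CARD('n)}. grassmannian e)"

definition directions :: "(real ^ 'n) set set" where
  "directions = (\<Union>e\<in>{1..CARD('n)}. grassmannian e)"

definition concise :: "(real ^ 'n) set set \<Rightarrow> bool" where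
  "concise \<L> \<longleftrightarrow> (\<forall>L\<in>\<L>. \<forall>L'\<in>\<L>. L \<subseteq> L' \<longrightarrow> L = L')"

definition subordinate :: "(real ^ 'n) set \<Rightarrow> (real ^ 'n) set set \<Rightarrow> bool" where
  "subordinate L \<L> \<longleftrightarrow> (\<exists>L'\<in>\<L>. L \<subseteq> L')"

definition rd_ergodic_dirs :: "'a measure \<Rightarrow> (real ^ 'n \<Rightarrow> 'a \<Rightarrow> 'a) \<Rightarrow> (real ^ 'n) set set" where
  "rd_ergodic_dirs M T = {L \<in> directions. ergodic_on M T L}"

definition rd_weak_mixing_dirs :: "'a measure \<Rightarrow> (real ^ 'n \<Rightarrow> 'a \<Rightarrow> 'a) \<Rightarrow> (real ^ 'n) set set" where
  "rd_weak_mixing_dirs M T = {L \<in> directions. weak_mixing_on M T L}"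

definition unit_cube :: "(real ^ 'n) set" where
  "unit_cube = {r. \<forall>i. 0 \<le> r $ i \<and> r $ i < 1}"

definition cube_measure :: "(real ^ 'n) measure" where
  "cube_measure = restrict_space lborel unit_cube"

definition susp_measure :: "'a measure \<Rightarrow> ('a \<times> (real ^ 'n)) measure" where
  "susp_measure M = M \<Otimes>\<^sub>M cube_measure"

definition suspension ::
    "(int ^ 'n \<Rightarrow> 'a \<Rightarrow> 'a) \<Rightarrow> real ^ 'n \<Rightarrow> 'a \<times> (real ^ 'n) \<Rightarrow> 'a \<times> (real ^ 'n)" where
  "suspension T t = (\<lambda>(x, r). (T (\<chi> i. \<lfloor>t $ i + r $ i\<rfloor>) x, \<chi> i. frac (t $ i + r $ i)))"

definition O_space :: "('a \<times> (real ^ 'n) \<Rightarrow> complex) set" where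
  "O_space = {F. \<exists>f\<in>L2 cube_measure. F = (\<lambda>(x, s). f s)}"

definition L2_O :: "'a measure \<Rightarrow> ('a \<times> (real ^ 'n) \<Rightarrow> complex) set" where
  "L2_O M = {F \<in> L2 (susp_measure M).
     \<forall>G\<in>O_space. integral\<^sup>L (susp_measure M) (\<lambda>y. F y * cnj (G y)) = 0}"

definition zd_ergodic_dirs :: "'a measure \<Rightarrow> (int ^ 'n \<Rightarrow> 'a \<Rightarrow> 'a) \<Rightarrow> (real ^ 'n) set set" where
  "zd_ergodic_dirs M T =
     {L \<in> directions. \<not> (\<exists>F\<in>L2_O M. dir_invariant (susp_measure M) (suspension T) L F)}"

definition zd_weak_mixing_dirs :: "'a measure \<Rightarrow> (int ^ 'n \<Rightarrow> 'a \<Rightarrow> 'a) \<Rightarrow> (real ^ 'n) set set" where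
  "zd_weak_mixing_dirs M T =
     {L \<in> directions. \<not> (\<exists>F\<in>L2_O M. dir_eigenfunction (susp_measure M) (suspension T) L F)}"

text \<open>The zero subspace lies in \<open>grassmannians\<close> but not in \<open>directions\<close>, hence in every complement.\<close>

definition structure_set :: "(real ^ 'n) set set \<Rightarrow> (real ^ 'n) set set \<Rightarrow> bool" where
  "structure_set \<D> \<N> \<longleftrightarrow>
     \<N> \<subseteq> grassmannians \<and> countable \<N> \<and> concise \<N> \<and>
     (\<forall>L\<in>grassmannians. L \<in> grassmannians - \<D> \<longleftrightarrow> subordinate L \<N>)"

end

theory Submission
  imports Defs
begin

text \<open>
  The members of the complement of \<open>\<E>\<^sub>T\<close> or \<open>\<W>\<^sub>T\<close> form a down-set of subspaces: an invariant function or
  eigenfunction of a direction \<open>L\<close> is one of every subspace of \<open>L\<close>, after projecting its frequency.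
  As dimensions are bounded, each member lies below a maximal one, and the set of maximal members is
  the only concise set that can generate the complement (\<open>ex1_structure_set\<close>).  What has to be proved
  is that there are only countably many maximal members.

  For this choose an eigenfunction \<open>f\<^sub>L\<close> for every nonzero maximal \<open>L\<close>.  These are pairwise orthogonal.  The
  acting group is abelian, so the orthogonal projection onto an eigenspace of \<open>L\<close> commutes with the
  flow; hence the projection \<open>p\<close> of \<open>f\<^bsub>L'\<^esub>\<close> is an eigenfunction for \<open>L\<close> and for \<open>L'\<close> simultaneously
  (\<open>eigenspace_projection\<close>).  If \<open>p\<close> were not zero, the two frequencies would agree on \<open>L \<inter> L'\<close> and glue
  to a frequency of \<open>L + L'\<close>, for which \<open>p\<close> would be an eigenfunction (\<open>eigenspace_glue\<close>); but \<open>L + L'\<close> is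
  strictly larger than the maximal \<open>L\<close>.  So \<open>p\<close> vanishes, which says that \<open>f\<^bsub>L'\<^esub>\<close> is orthogonal to
  \<open>f\<^sub>L\<close>.  Separability of \<open>L\<^sup>2\<close> then leaves room for only countably many maximal \<open>L\<close>.

  The argument runs inside the orthogonal complement of a family \<open>Q\<close> of functions that the flow
  preserves.  For a flow \<open>Q\<close> consists of the constants; for a \<open>\<int>\<^sup>d\<close>-action the flow is the unit suspension
  and \<open>Q\<close> is the space of functions of the cube coordinate.  Ergodicity and weak mixing differ only
  in the frequencies that are admitted, \<open>0\<close> or all of \<open>L\<close>.

  The analytic ingredients are the projection theorem in \<open>L\<^sup>2\<close>, which rests on completeness
  (\<open>L2_complete\<close>); the fact that countably many sets detect a nonzero integrable function on a Lebesgue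
  space and on its product with the cube (\<open>lebesgue_prob_space_countably_total\<close>,
  \<open>countably_total_pair\<close>); and that the suspension preserves the product measure
  (\<open>distr_suspension\<close>).
\<close>

section \<open>Down-sets of subspaces and their maximal elements\<close>

lemma subspace_iff_grassmannians: "(L :: (real ^ 'n) set) \<in> grassmannians \<longleftrightarrow> subspace L"
  using dim_subset_UNIV[of L] by (auto simp: grassmannians_def grassmannian_def)

lemma directions_iff: "(L :: (real ^ 'n) set) \<in> directions \<longleftrightarrow> subspace L \<and> L \<noteq> {0}"
proof -
  have "1 \<le> dim L \<longleftrightarrow> L \<noteq> {0}" if "subspace L"
  proof -
    have "L \<noteq> {}" using subspace_0[OF that] by auto
    then have "dim L = 0 \<longleftrightarrow> L = {0}"
      unfolding dim_eq_0 by blast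
    then show ?thesis by linarith
  qed
  moreover have "dim L \<le> CARD('n)" using dim_subset_UNIV[of L] by simp
  ultimately show ?thesis
    unfolding directions_def grassmannian_def UN_iff mem_Collect_eq by (metis atLeastAtMost_iff)
qed

definition maximal_members :: "'a set set \<Rightarrow> 'a set set" where
  "maximal_members \<C> = {L \<in> \<C>. \<forall>L'\<in>\<C>. L \<subseteq> L' \<longrightarrow> L = L'}"

lemma subspace_below_maximal_member:
  fixes \<C> :: "(real ^ 'n) set set"
  assumes sub: "\<And>L. L \<in> \<C> \<Longrightarrow> subspace L" and L: "L \<in> \<C>"
  shows "subordinate L (maximal_members \<C>)"
proof -
  define P where "P L' \<longleftrightarrow> L' \<in> \<C> \<and> L \<subseteq> L'" for L'
  have "P L" using L by (simp add: P_def)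
  moreover have "\<forall>y. P y \<longrightarrow> dim y < Suc CARD('n)"
    using dim_subset_UNIV[where 'a = "real ^ 'n"] by (auto simp: less_Suc_eq_le)
  ultimately obtain M where M: "P M" "\<And>y. P y \<Longrightarrow> dim y \<le> dim M"
    using ex_has_greatest_nat[of P L dim] by blast
  have "M = M'" if "M' \<in> \<C>" "M \<subseteq> M'" for M'
  proof (rule subspace_dim_equal)
    show "dim M' \<le> dim M" using M that by (auto simp: P_def)
  qed (use M that sub in \<open>auto simp: P_def\<close>)
  then show ?thesis
    using M by (auto simp: subordinate_def maximal_members_def P_def)
qed

text \<open>
  A structure set of \<open>\<D>\<close> can only be the set of maximal members of the complement of \<open>\<D>\<close>.
  Maximal members exist above every member because dimensions are bounded, so the existence of a
  structure set amounts to the complement being a down-set with countably many maximal members.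
\<close>

lemma ex1_structure_set:
  fixes \<D> :: "(real ^ 'n) set set"
  assumes down: "\<And>L L'. L' \<in> grassmannians - \<D> \<Longrightarrow> subspace L \<Longrightarrow> L \<subseteq> L' \<Longrightarrow> L \<notin> \<D>"
    and count: "countable (maximal_members (grassmannians - \<D>))"
  shows "\<exists>!\<N>. structure_set \<D> \<N>"
proof
  let ?C = "grassmannians - \<D>"
  have below: "subordinate L (maximal_members ?C)" if "L \<in> ?C" for L
    using that by (intro subspace_below_maximal_member) (auto simp: subspace_iff_grassmannians)
  have "concise (maximal_members ?C)"
    by (auto simp: concise_def maximal_members_def)
  moreover have "L \<in> ?C" if "subordinate L (maximal_members ?C)" "L \<in> grassmannians" for L
    using that down by (auto simp: subordinate_def maximal_members_def subspace_iff_grassmannians)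
  moreover have "maximal_members ?C \<subseteq> grassmannians"
    by (auto simp: maximal_members_def)
  ultimately show "structure_set \<D> (maximal_members ?C)"
    unfolding structure_set_def using count below by blast
  fix \<N> assume N: "structure_set \<D> \<N>"
  then have iff: "L \<in> ?C \<longleftrightarrow> subordinate L \<N>" if "L \<in> grassmannians" for L
    using that by (auto simp: structure_set_def)
  have NC: "\<N> \<subseteq> ?C"
    using N iff by (fastforce simp: structure_set_def subordinate_def)
  show "\<N> = maximal_members ?C"
  proof
    show "\<N> \<subseteq> maximal_members ?C"
    proof
      fix L assume L: "L \<in> \<N>"
      have "L = L'" if L': "L' \<in> ?C" "L \<subseteq> L'" for L'
      proof -
        obtain L'' where "L'' \<in> \<N>" "L' \<subseteq> L''"
          using iff[of L'] L' by (auto simp: subordinate_def)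
        moreover from this have "L = L''"
          using N L that by (auto simp: structure_set_def concise_def)
        ultimately show ?thesis using that by auto
      qed
      then show "L \<in> maximal_members ?C"
        using L NC by (auto simp: maximal_members_def)
    qed
    show "maximal_members ?C \<subseteq> \<N>"
    proof
      fix L assume L: "L \<in> maximal_members ?C"
      then obtain L' where "L' \<in> \<N>" "L \<subseteq> L'"
        using iff[of L] unfolding subordinate_def maximal_members_def by blast
      then show "L \<in> \<N>" using L NC by (auto simp: maximal_members_def)
    qed
  qed
qed

section \<open>Frequencies on a sum of subspaces\<close>

abbreviation subspace_sum :: "(real ^ 'n) set \<Rightarrow> (real ^ 'n) set \<Rightarrow> (real ^ 'n) set" where
  "subspace_sum L L' \<equiv> {x + y |x y. x \<in> L \<and> y \<in> L'}"

lemma orthogonal_decomposition: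
  fixes l :: "real ^ 'n"
  assumes "subspace L"
  obtains p z where "p \<in> L" "l = p + z" "\<And>t. t \<in> L \<Longrightarrow> z \<bullet> t = 0"
proof -
  obtain y z where "y \<in> span L" "\<And>w. w \<in> span L \<Longrightarrow> orthogonal z w" "l = y + z"
    by (rule orthogonal_subspace_decomp_exists[where S = L and x = l]) blast
  moreover have "span L = L" using assms by (simp add: span_eq_iff)
  ultimately show ?thesis
    using that by (simp add: orthogonal_def)
qed

lemma frequency_restrict:
  fixes l :: "real ^ 'n"
  assumes "subspace L"
  obtains m where "m \<in> L" "\<And>t. t \<in> L \<Longrightarrow> m \<bullet> t = l \<bullet> t"
proof -
  obtain p z where "p \<in> L" "l = p + z" "\<And>t. t \<in> L \<Longrightarrow> z \<bullet> t = 0"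
    using orthogonal_decomposition[OF assms] by blast
  then show ?thesis by (intro that[of p]) (auto simp: inner_add_left)
qed

text \<open>
  Orthogonal complements turn the agreement on \<open>L \<inter> L'\<close> into a decomposition \<open>l' - l = a + b\<close> with \<open>a\<close>
  orthogonal to \<open>L\<close> and \<open>b\<close> orthogonal to \<open>L'\<close>.  Then \<open>l + a = l' - b\<close> induces both functionals, and its
  projection to \<open>L + L'\<close> does so from within the sum.
\<close>

lemma frequency_glue:
  fixes l l' :: "real ^ 'n"
  assumes L: "subspace L" "subspace L'"
    and agree: "\<And>t. t \<in> L \<Longrightarrow> t \<in> L' \<Longrightarrow> l \<bullet> t = l' \<bullet> t"
  obtains m where "m \<in> subspace_sum L L'"
    "\<And>t. t \<in> L \<Longrightarrow> m \<bullet> t = l \<bullet> t" "\<And>t. t \<in> L' \<Longrightarrow> m \<bullet> t = l' \<bullet> t"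
proof -
  let ?V = "subspace_sum (orthogonal_comp L) (orthogonal_comp L')"
  have V: "subspace ?V"
    by (intro subspace_sums subspace_orthogonal_comp)
  have inV: "orthogonal_comp L \<subseteq> ?V" "orthogonal_comp L' \<subseteq> ?V"
    using subspace_0[OF subspace_orthogonal_comp[of L]] subspace_0[OF subspace_orthogonal_comp[of L']]
    by force+
  have "orthogonal_comp ?V \<subseteq> L \<inter> L'"
    using orthogonal_comp_anti_mono[OF inV(1)] orthogonal_comp_anti_mono[OF inV(2)]
    unfolding orthogonal_comp_self[OF L(1)] orthogonal_comp_self[OF L(2)] by blast
  then have "l' - l \<in> orthogonal_comp (orthogonal_comp ?V)"
    using agree
    by (auto simp: orthogonal_comp_def[of "orthogonal_comp ?V"] orthogonal_def inner_diff_right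
        inner_commute[of _ l] inner_commute[of _ l'] subset_iff)
  then have "l' - l \<in> ?V" using orthogonal_comp_self[OF V] by auto
  then obtain a b where ab: "a \<in> orthogonal_comp L" "b \<in> orthogonal_comp L'" "l' - l = a + b"
    by auto
  have "subspace (subspace_sum L L')" using L by (rule subspace_sums)
  then obtain m where m: "m \<in> subspace_sum L L'"
      "\<And>t. t \<in> subspace_sum L L' \<Longrightarrow> m \<bullet> t = (l + a) \<bullet> t"
    using frequency_restrict by blast
  have sub: "L \<subseteq> subspace_sum L L'" "L' \<subseteq> subspace_sum L L'"
    using subspace_0[OF L(1)] subspace_0[OF L(2)] by force+
  have la: "l + a = l' - b" using ab(3) by (simp add: algebra_simps)
  show ?thesis
  proof (rule that[OF m(1)])
    fix t assume t: "t \<in> L"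
    then have "a \<bullet> t = 0"
      using ab(1) by (simp add: orthogonal_comp_def orthogonal_def inner_commute[of a])
    then show "m \<bullet> t = l \<bullet> t"
      using m(2)[of t] t sub(1) by (auto simp: inner_add_left)
  next
    fix t assume t: "t \<in> L'"
    then have "b \<bullet> t = 0"
      using ab(2) by (simp add: orthogonal_comp_def orthogonal_def inner_commute[of b])
    then show "m \<bullet> t = l' \<bullet> t"
      using m(2)[of t] t sub(2) unfolding la by (auto simp: inner_diff_left)
  qed
qed

section \<open>Inner products of square integrable functions\<close>

lemma borel_measurable_cnj [measurable]:
  "f \<in> borel_measurable M \<Longrightarrow> (\<lambda>x. cnj (f x)) \<in> borel_measurable M"
  by (rule borel_measurable_continuous_on[where f = cnj]) (auto intro: continuous_intros)

definition l2_inner :: "'a measure \<Rightarrow> ('a \<Rightarrow> complex) \<Rightarrow> ('a \<Rightarrow> complex) \<Rightarrow> complex" where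
  "l2_inner M f g = (\<integral>x. f x * cnj (g x) \<partial>M)"

definition l2_normsq :: "'a measure \<Rightarrow> ('a \<Rightarrow> complex) \<Rightarrow> real" where
  "l2_normsq M f = (\<integral>x. (cmod (f x))\<^sup>2 \<partial>M)"

lemma L2_measurable [measurable_dest]: "f \<in> L2 M \<Longrightarrow> f \<in> borel_measurable M"
  by (simp add: L2_def)

lemma L2_integrable_normsq: "f \<in> L2 M \<Longrightarrow> integrable M (\<lambda>x. (cmod (f x))\<^sup>2)"
  by (simp add: L2_def)

lemma cmod_mult_le_sum_squares: "cmod (a * b) \<le> (cmod a)\<^sup>2 + (cmod b)\<^sup>2"
proof -
  have "2 * (cmod a * cmod b) \<le> (cmod a)\<^sup>2 + (cmod b)\<^sup>2"
    using sum_squares_bound[of "cmod a" "cmod b"] by simp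
  moreover have "0 \<le> cmod a * cmod b" by simp
  ultimately show ?thesis unfolding norm_mult by linarith
qed

lemma L2_mult_integrable:
  assumes f: "f \<in> L2 M" and g: "g \<in> L2 M"
  shows "integrable M (\<lambda>x. f x * cnj (g x))"
proof (rule Bochner_Integration.integrable_bound)
  show "integrable M (\<lambda>x. (cmod (f x))\<^sup>2 + (cmod (g x))\<^sup>2)"
    using f g by (intro Bochner_Integration.integrable_add L2_integrable_normsq)
  show "(\<lambda>x. f x * cnj (g x)) \<in> borel_measurable M"
    using f g by measurable
  show "AE x in M. norm (f x * cnj (g x)) \<le> norm ((cmod (f x))\<^sup>2 + (cmod (g x))\<^sup>2)"
  proof (rule AE_I2)
    fix x
    show "norm (f x * cnj (g x)) \<le> norm ((cmod (f x))\<^sup>2 + (cmod (g x))\<^sup>2)"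
      using cmod_mult_le_sum_squares[of "f x" "cnj (g x)"] by simp
  qed
qed

lemma L2_scale: "f \<in> L2 M \<Longrightarrow> (\<lambda>x. c * f x) \<in> L2 M"
  by (auto simp: L2_def norm_mult power_mult_distrib)

lemma L2_add:
  assumes f: "f \<in> L2 M" and g: "g \<in> L2 M"
  shows "(\<lambda>x. f x + g x) \<in> L2 M"
proof -
  have "integrable M (\<lambda>x. (cmod (f x + g x))\<^sup>2)"
  proof (rule Bochner_Integration.integrable_bound)
    show "integrable M (\<lambda>x. 2 * (cmod (f x))\<^sup>2 + 2 * (cmod (g x))\<^sup>2)"
      using f g by (intro Bochner_Integration.integrable_add integrable_mult_right L2_integrable_normsq)
    show "(\<lambda>x. (cmod (f x + g x))\<^sup>2) \<in> borel_measurable M"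
      using f g by measurable
    show "AE x in M. norm ((cmod (f x + g x))\<^sup>2) \<le> norm (2 * (cmod (f x))\<^sup>2 + 2 * (cmod (g x))\<^sup>2)"
    proof (rule AE_I2)
      fix x
      have "(cmod (f x + g x))\<^sup>2 \<le> (cmod (f x) + cmod (g x))\<^sup>2"
        by (intro power_mono norm_triangle_ineq) simp
      also have "\<dots> \<le> 2 * (cmod (f x))\<^sup>2 + 2 * (cmod (g x))\<^sup>2"
        using sum_squares_bound[of "cmod (f x)" "cmod (g x)"] by (simp add: power2_sum)
      finally show "norm ((cmod (f x + g x))\<^sup>2) \<le> norm (2 * (cmod (f x))\<^sup>2 + 2 * (cmod (g x))\<^sup>2)"
        by simp
    qed
  qed
  then show ?thesis
    using borel_measurable_add[OF L2_measurable[OF f] L2_measurable[OF g]] by (simp add: L2_def)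
qed

lemma L2_diff: "f \<in> L2 M \<Longrightarrow> g \<in> L2 M \<Longrightarrow> (\<lambda>x. f x - g x) \<in> L2 M"
  using L2_add[of f M "\<lambda>x. (-1) * g x"] L2_scale[of g M "-1"] by simp

lemma (in finite_measure) L2_const: "(\<lambda>_. c) \<in> L2 M"
  by (simp add: L2_def)

lemma (in finite_measure) L2_integrable: "f \<in> L2 M \<Longrightarrow> integrable M f"
  using L2_mult_integrable[OF _ L2_const[of 1], of f] by simp

lemma l2_inner_add_left:
  "f \<in> L2 M \<Longrightarrow> g \<in> L2 M \<Longrightarrow> h \<in> L2 M \<Longrightarrow>
    l2_inner M (\<lambda>x. f x + g x) h = l2_inner M f h + l2_inner M g h"
  unfolding l2_inner_def by (simp add: distrib_right L2_mult_integrable)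

lemma l2_inner_diff_left:
  "f \<in> L2 M \<Longrightarrow> g \<in> L2 M \<Longrightarrow> h \<in> L2 M \<Longrightarrow>
    l2_inner M (\<lambda>x. f x - g x) h = l2_inner M f h - l2_inner M g h"
  unfolding l2_inner_def by (simp add: left_diff_distrib L2_mult_integrable)

lemma l2_inner_scale_left: "l2_inner M (\<lambda>x. c * f x) h = c * l2_inner M f h"
  unfolding l2_inner_def by (simp add: mult.assoc)

lemma l2_inner_commute: "l2_inner M g f = cnj (l2_inner M f g)"
  unfolding l2_inner_def using Bochner_Integration.integral_cnj[of M "\<lambda>x. f x * cnj (g x)"] by (simp add: mult.commute)

lemma l2_inner_diff_right:
  "f \<in> L2 M \<Longrightarrow> g \<in> L2 M \<Longrightarrow> h \<in> L2 M \<Longrightarrow>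
    l2_inner M h (\<lambda>x. f x - g x) = l2_inner M h f - l2_inner M h g"
  using l2_inner_diff_left[of f M g h] l2_inner_commute by (metis complex_cnj_diff)

lemma l2_inner_scale_right: "l2_inner M h (\<lambda>x. c * f x) = cnj c * l2_inner M h f"
  using l2_inner_scale_left[of M c f h] l2_inner_commute by (metis complex_cnj_mult)

lemma l2_inner_self: "l2_inner M f f = of_real (l2_normsq M f)"
  unfolding l2_inner_def l2_normsq_def complex_norm_square[symmetric] by (rule integral_complex_of_real)

lemma l2_normsq_nonneg: "0 \<le> l2_normsq M f"
  unfolding l2_normsq_def by simp

lemma l2_inner_cong_AE:
  assumes "AE x in M. f x = f' x" "f \<in> L2 M" "f' \<in> L2 M" "h \<in> L2 M"
  shows "l2_inner M f h = l2_inner M f' h"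
  unfolding l2_inner_def using assms by (intro integral_cong_AE) (auto simp: L2_def)

lemma l2_normsq_eq_0_iff:
  assumes "f \<in> L2 M"
  shows "l2_normsq M f = 0 \<longleftrightarrow> (AE x in M. f x = 0)"
  unfolding l2_normsq_def
  using integral_nonneg_eq_0_iff_AE[OF L2_integrable_normsq[OF assms]] by simp

lemma l2_normsq_diff_scale:
  assumes "f \<in> L2 M" "g \<in> L2 M"
  shows "l2_normsq M (\<lambda>x. f x - c * g x)
    = l2_normsq M f - 2 * Re (cnj c * l2_inner M f g) + (cmod c)\<^sup>2 * l2_normsq M g"
proof -
  have "of_real (l2_normsq M (\<lambda>x. f x - c * g x))
      = l2_inner M f f - cnj c * l2_inner M f g - (c * l2_inner M g f - c * (cnj c * l2_inner M g g))"
    unfolding l2_inner_self[symmetric]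
    using assms by (simp add: l2_inner_diff_left l2_inner_diff_right L2_scale L2_diff
        l2_inner_scale_left l2_inner_scale_right right_diff_distrib)
  also have "\<dots> = of_real (l2_normsq M f) - (cnj c * l2_inner M f g + cnj (cnj c * l2_inner M f g))
      + c * cnj c * of_real (l2_normsq M g)"
    by (simp add: l2_inner_self l2_inner_commute[of M g f])
  also have "\<dots> = of_real (l2_normsq M f - 2 * Re (cnj c * l2_inner M f g) + (cmod c)\<^sup>2 * l2_normsq M g)"
    unfolding complex_add_cnj complex_norm_square[symmetric] by simp
  finally show ?thesis unfolding of_real_eq_iff .
qed

text \<open>
  The coefficient \<open>\<langle>f, g\<rangle> / \<parallel>g\<parallel>\<^sup>2\<close> is the one that minimises the distance; the inequalities of
  Cauchy-Schwarz and Bessel, and the orthogonality of a best approximation, all follow from the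
  value of that minimum.
\<close>

lemma l2_normsq_diff_projection:
  assumes "f \<in> L2 M" "g \<in> L2 M" and pos: "l2_normsq M g > 0"
  shows "l2_normsq M (\<lambda>x. f x - (l2_inner M f g / of_real (l2_normsq M g)) * g x)
    = l2_normsq M f - (cmod (l2_inner M f g))\<^sup>2 / l2_normsq M g"
proof -
  define a N where "a = l2_inner M f g" and "N = l2_normsq M g"
  have N: "N > 0" using pos by (simp add: N_def)
  have "Re (cnj (a / of_real N) * a) = (cmod a)\<^sup>2 / N"
  proof -
    have "cnj (a / of_real N) * a = of_real ((cmod a)\<^sup>2 / N)"
      by (simp add: complex_norm_square mult.commute del: of_real_power)
    then show ?thesis by (simp only: Re_complex_of_real)
  qed
  moreover have "(cmod (a / of_real N))\<^sup>2 * N = (cmod a)\<^sup>2 / N"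
    using N by (simp add: norm_divide power_divide power2_eq_square)
  ultimately show ?thesis
    using l2_normsq_diff_scale[OF assms(1,2), of "a / of_real N"]
    unfolding a_def[symmetric] N_def[symmetric] by linarith
qed

lemma l2_inner_normsq_0:
  assumes "f \<in> L2 M" "g \<in> L2 M" "l2_normsq M g = 0"
  shows "l2_inner M f g = 0"
proof -
  have "AE x in M. g x = 0" using assms l2_normsq_eq_0_iff by blast
  then have "l2_inner M f g = l2_inner M f (\<lambda>x. 0 * g x)"
    unfolding l2_inner_def using assms by (intro integral_cong_AE) (auto simp: L2_def)
  then show ?thesis by (simp add: l2_inner_def)
qed

lemma l2_best_approximation_bound:
  assumes "f \<in> L2 M" "g \<in> L2 M" and best: "\<And>c. d \<le> l2_normsq M (\<lambda>x. f x - c * g x)"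
  shows "(cmod (l2_inner M f g))\<^sup>2 \<le> (l2_normsq M f - d) * l2_normsq M g"
proof (cases "l2_normsq M g = 0")
  case True
  then show ?thesis using l2_inner_normsq_0 assms by simp
next
  case False
  then have pos: "l2_normsq M g > 0" using l2_normsq_nonneg[of M g] by simp
  then have "d \<le> l2_normsq M f - (cmod (l2_inner M f g))\<^sup>2 / l2_normsq M g"
    using best[of "l2_inner M f g / of_real (l2_normsq M g)"] l2_normsq_diff_projection[OF assms(1,2) pos]
    by linarith
  then show ?thesis using pos by (simp add: field_simps)
qed

lemma l2_Cauchy_Schwarz:
  "f \<in> L2 M \<Longrightarrow> g \<in> L2 M \<Longrightarrow> (cmod (l2_inner M f g))\<^sup>2 \<le> l2_normsq M f * l2_normsq M g"
  using l2_best_approximation_bound[of f M g 0] l2_normsq_nonneg by auto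

lemma l2_parallelogram:
  assumes f: "f \<in> L2 M" and g: "g \<in> L2 M"
  shows "l2_normsq M (\<lambda>x. f x - g x)
    = 2 * l2_normsq M f + 2 * l2_normsq M g - 4 * l2_normsq M (\<lambda>x. 1/2 * (f x + g x))"
proof -
  have "(\<lambda>x. 1/2 * (f x + g x)) \<in> L2 M" using f g by (intro L2_scale L2_add)
  then have "2 * l2_normsq M f + 2 * l2_normsq M g - 4 * l2_normsq M (\<lambda>x. 1/2 * (f x + g x))
    = (\<integral>x. 2 * (cmod (f x))\<^sup>2 + 2 * (cmod (g x))\<^sup>2 - 4 * (cmod (1/2 * (f x + g x)))\<^sup>2 \<partial>M)"
    unfolding l2_normsq_def using f g L2_integrable_normsq[of "\<lambda>x. 1/2 * (f x + g x)" M]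
    by (simp add: L2_integrable_normsq del: times_divide_eq_left mult_numeral_1)
  also have "\<dots> = l2_normsq M (\<lambda>x. f x - g x)"
  proof -
    have "2 * (cmod a)\<^sup>2 + 2 * (cmod b)\<^sup>2 - 4 * (cmod (1/2 * (a + b)))\<^sup>2 = (cmod (a - b))\<^sup>2" for a b
      by (simp add: norm_divide power_divide cmod_power2) (simp add: power2_eq_square algebra_simps)
    then show ?thesis unfolding l2_normsq_def by simp
  qed
  finally show ?thesis by simp
qed

section \<open>Completeness and orthogonal projection\<close>

lemma (in prob_space) integral_cmod_le:
  assumes "f \<in> L2 M" and "l2_normsq M f \<le> e\<^sup>2" and "e > 0"
  shows "(\<integral>x. cmod (f x) \<partial>M) \<le> e"
proof -
  have int: "integrable M f" using assms L2_integrable by blast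
  have "(\<integral>x. cmod (f x) \<partial>M) \<le> (\<integral>x. e / 2 + (cmod (f x))\<^sup>2 / (2 * e) \<partial>M)"
  proof (rule integral_mono)
    show "integrable M (\<lambda>x. cmod (f x))" using int by simp
    show "integrable M (\<lambda>x. e / 2 + (cmod (f x))\<^sup>2 / (2 * e))"
      using L2_integrable_normsq[OF assms(1)] by simp
    fix x
    \<comment> \<open>Weighted so that each of the two terms integrates to at most \<open>e / 2\<close>.\<close>
    have "2 * cmod (f x) * e \<le> (cmod (f x))\<^sup>2 + e\<^sup>2"
      by (rule sum_squares_bound)
    then show "cmod (f x) \<le> e / 2 + (cmod (f x))\<^sup>2 / (2 * e)"
      using assms(3) by (simp add: field_simps power2_eq_square)
  qed
  also have "\<dots> = e / 2 + l2_normsq M f / (2 * e)"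
    using L2_integrable_normsq[OF assms(1)] by (simp add: l2_normsq_def prob_space)
  also have "\<dots> \<le> e"
    using assms(2,3) by (simp add: field_simps power2_eq_square)
  finally show ?thesis .
qed

lemma nn_integral_eq_l2_normsq:
  assumes "f \<in> L2 M"
  shows "(\<integral>\<^sup>+x. ennreal ((cmod (f x))\<^sup>2) \<partial>M) = ennreal (l2_normsq M f)"
  unfolding l2_normsq_def using assms by (intro nn_integral_eq_integral L2_integrable_normsq) auto

text \<open>
  On a probability space a sequence that is Cauchy in mean square is Cauchy in mean, so that a
  subsequence converges almost everywhere; Fatou's lemma along that subsequence makes the pointwise
  limit a mean square limit.
\<close>

lemma (in prob_space) L2_complete:
  assumes f: "\<And>n. f n \<in> L2 M"
    and cauchy: "\<And>e. e > 0 \<Longrightarrow> \<exists>N. \<forall>i\<ge>N. \<forall>j\<ge>N. l2_normsq M (\<lambda>x. f i x - f j x) < e"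
  obtains g where "g \<in> L2 M" "(\<lambda>n. l2_normsq M (\<lambda>x. f n x - g x)) \<longlonglongrightarrow> 0"
proof -
  have fm [measurable]: "f n \<in> borel_measurable M" for n using f by (simp add: L2_measurable)
  have fint: "integrable M (f n)" for n using f by (simp add: L2_integrable)
  have L1: "\<exists>N. \<forall>i\<ge>N. \<forall>j\<ge>N. (\<integral>x. cmod (f i x - f j x) \<partial>M) < e" if e: "e > 0" for e
  proof -
    obtain N where N: "\<And>i j. i \<ge> N \<Longrightarrow> j \<ge> N \<Longrightarrow> l2_normsq M (\<lambda>x. f i x - f j x) < (e/2)\<^sup>2"
      using cauchy[of "(e/2)\<^sup>2"] e by (auto simp: power2_eq_square)
    have "(\<integral>x. cmod (f i x - f j x) \<partial>M) < e" if "i \<ge> N" "j \<ge> N" for i j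
    proof -
      have "(\<integral>x. cmod (f i x - f j x) \<partial>M) \<le> e/2"
        using integral_cmod_le[OF L2_diff[OF f f], of i j "e/2"] N[OF that] e by simp
      then show ?thesis using e by simp
    qed
    then show ?thesis by blast
  qed
  obtain r where r: "strict_mono r" and "AE x in M. Cauchy (\<lambda>i. f (r i) x)"
    using cauchy_L1_AE_cauchy_subseq[OF fint L1] by blast
  define g where "g x = lim (\<lambda>i. f (r i) x)" for x
  have gm [measurable]: "g \<in> borel_measurable M"
    unfolding g_def by measurable
  have lim: "AE x in M. (\<lambda>i. f (r i) x) \<longlonglongrightarrow> g x"
    using \<open>AE x in M. Cauchy (\<lambda>i. f (r i) x)\<close>
    by eventually_elim (simp add: g_def Cauchy_convergent convergent_LIMSEQ_iff[symmetric])
  have fatou: "(\<integral>\<^sup>+x. ennreal ((cmod (f n x - g x))\<^sup>2) \<partial>M) \<le> ennreal e"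
    if N: "\<And>j. j \<ge> N \<Longrightarrow> l2_normsq M (\<lambda>x. f n x - f j x) \<le> e" for n N e
  proof -
    have "(\<integral>\<^sup>+x. ennreal ((cmod (f n x - g x))\<^sup>2) \<partial>M)
        = (\<integral>\<^sup>+x. liminf (\<lambda>i. ennreal ((cmod (f n x - f (r i) x))\<^sup>2)) \<partial>M)"
    proof (rule nn_integral_cong_AE)
      show "AE x in M. ennreal ((cmod (f n x - g x))\<^sup>2) = liminf (\<lambda>i. ennreal ((cmod (f n x - f (r i) x))\<^sup>2))"
        using lim
      proof eventually_elim
        case (elim x)
        then have "(\<lambda>i. ennreal ((cmod (f n x - f (r i) x))\<^sup>2)) \<longlonglongrightarrow> ennreal ((cmod (f n x - g x))\<^sup>2)"
          by (intro tendsto_ennrealI tendsto_intros)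
        then show ?case by (intro lim_imp_Liminf[symmetric]) simp
      qed
    qed
    also have "\<dots> \<le> liminf (\<lambda>i. \<integral>\<^sup>+x. ennreal ((cmod (f n x - f (r i) x))\<^sup>2) \<partial>M)"
      by (rule nn_integral_liminf) measurable
    also have "\<dots> \<le> limsup (\<lambda>i. \<integral>\<^sup>+x. ennreal ((cmod (f n x - f (r i) x))\<^sup>2) \<partial>M)"
      by (rule Liminf_le_Limsup) simp
    also have "\<dots> \<le> ennreal e"
    proof (rule Limsup_bounded)
      show "\<forall>\<^sub>F i in sequentially. (\<integral>\<^sup>+x. ennreal ((cmod (f n x - f (r i) x))\<^sup>2) \<partial>M) \<le> ennreal e"
        using eventually_ge_at_top[of N]
      proof eventually_elim
        case (elim i)
        then have "r i \<ge> N" using seq_suble[OF r, of i] by linarith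
        then show ?case
          unfolding nn_integral_eq_l2_normsq[OF L2_diff[OF f f]] using N by (intro ennreal_leI)
      qed
    qed
    finally show ?thesis .
  qed
  have diff: "(\<lambda>x. f n x - g x) \<in> L2 M"
    if "\<And>j. j \<ge> N \<Longrightarrow> l2_normsq M (\<lambda>x. f n x - f j x) \<le> e" for n N e
  proof -
    have "(\<integral>\<^sup>+x. ennreal ((cmod (f n x - g x))\<^sup>2) \<partial>M) \<le> ennreal e"
      using that by (rule fatou)
    also have "\<dots> < \<infinity>" by simp
    finally show ?thesis by (simp add: L2_def integrable_iff_bounded)
  qed
  obtain N1 where "\<forall>i\<ge>N1. \<forall>j\<ge>N1. l2_normsq M (\<lambda>x. f i x - f j x) < 1"
    using cauchy[of 1] by auto
  then have "(\<lambda>x. f N1 x - g x) \<in> L2 M"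
    by (intro diff[of N1 N1 1] less_imp_le) auto
  from L2_diff[OF f[of N1] this] have g: "g \<in> L2 M"
    by simp
  have "(\<lambda>n. l2_normsq M (\<lambda>x. f n x - g x)) \<longlonglongrightarrow> 0"
  proof (rule LIMSEQ_I)
    fix e :: real assume e: "e > 0"
    then obtain N where N: "\<And>i j. i \<ge> N \<Longrightarrow> j \<ge> N \<Longrightarrow> l2_normsq M (\<lambda>x. f i x - f j x) < e/2"
      using cauchy[of "e/2"] by auto
    have "l2_normsq M (\<lambda>x. f n x - g x) \<le> e/2" if "n \<ge> N" for n
    proof -
      have "ennreal (l2_normsq M (\<lambda>x. f n x - g x)) \<le> ennreal (e/2)"
        using fatou[of N n "e/2"] N[OF that] nn_integral_eq_l2_normsq[OF L2_diff[OF f g]]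
        by (simp add: less_imp_le)
      then show ?thesis using e by (subst (asm) ennreal_le_iff) auto
    qed
    then have "\<forall>n\<ge>N. norm (l2_normsq M (\<lambda>x. f n x - g x) - 0) < e"
      using e l2_normsq_nonneg[of M] by (fastforce simp: abs_of_nonneg)
    then show "\<exists>N. \<forall>n\<ge>N. norm (l2_normsq M (\<lambda>x. f n x - g x) - 0) < e" ..
  qed
  then show ?thesis using g that by blast
qed

definition l2_perp :: "'a measure \<Rightarrow> ('a \<Rightarrow> complex) set \<Rightarrow> ('a \<Rightarrow> complex) set" where
  "l2_perp M Q = {f \<in> L2 M. \<forall>h\<in>Q. l2_inner M f h = 0}"

lemma l2_perp_L2: "f \<in> l2_perp M Q \<Longrightarrow> f \<in> L2 M"
  by (simp add: l2_perp_def)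

lemma l2_perp_diff:
  "Q \<subseteq> L2 M \<Longrightarrow> f \<in> l2_perp M Q \<Longrightarrow> g \<in> l2_perp M Q \<Longrightarrow> (\<lambda>x. f x - g x) \<in> l2_perp M Q"
  by (auto simp: l2_perp_def L2_diff l2_inner_diff_left subset_iff)

lemma l2_perp_add:
  "Q \<subseteq> L2 M \<Longrightarrow> f \<in> l2_perp M Q \<Longrightarrow> g \<in> l2_perp M Q \<Longrightarrow> (\<lambda>x. f x + g x) \<in> l2_perp M Q"
  by (auto simp: l2_perp_def L2_add l2_inner_add_left subset_iff)

lemma l2_perp_scale: "f \<in> l2_perp M Q \<Longrightarrow> (\<lambda>x. c * f x) \<in> l2_perp M Q"
  by (simp add: l2_perp_def L2_scale l2_inner_scale_left)

text \<open>
  A minimising sequence for the distance from \<open>f\<close> is Cauchy by the parallelogram law, and its limit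
  is a best approximation, hence has orthogonal remainder.  An orthogonal complement contains its
  mean square limits by the Cauchy-Schwarz inequality.
\<close>

lemma (in prob_space) l2_projection_exists:
  assumes Q: "Q \<subseteq> L2 M" and f: "f \<in> L2 M"
  obtains p where "p \<in> l2_perp M Q" "\<And>k. k \<in> l2_perp M Q \<Longrightarrow> l2_inner M (\<lambda>x. f x - p x) k = 0"
proof -
  define S where "S = (\<lambda>k. l2_normsq M (\<lambda>x. f x - k x)) ` l2_perp M Q"
  define d where "d = Inf S"
  have "(\<lambda>_. 0) \<in> l2_perp M Q"
    by (simp add: l2_perp_def L2_const l2_inner_def)
  then have ne: "S \<noteq> {}" by (auto simp: S_def)
  have bdd: "bdd_below S"
    by (rule bdd_belowI[of _ 0]) (auto simp: S_def l2_normsq_nonneg)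
  have d: "d \<le> l2_normsq M (\<lambda>x. f x - k x)" if "k \<in> l2_perp M Q" for k
    unfolding d_def using that by (intro cInf_lower bdd) (auto simp: S_def)
  have "\<exists>k\<in>l2_perp M Q. l2_normsq M (\<lambda>x. f x - k x) < d + 1 / Suc n" for n
    using cInf_lessD[OF ne, of "d + 1 / Suc n"] by (auto simp: d_def S_def)
  then obtain k where k: "\<And>n. k n \<in> l2_perp M Q"
      and kd: "\<And>n. l2_normsq M (\<lambda>x. f x - k n x) < d + 1 / Suc n"
    by metis
  have kL: "k n \<in> L2 M" for n using k l2_perp_L2 by blast
  have near: "l2_normsq M (\<lambda>x. k i x - k j x) \<le> 2 / Suc i + 2 / Suc j" for i j
  proof -
    have mid: "(\<lambda>x. 1/2 * (k i x + k j x)) \<in> l2_perp M Q"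
      using k by (intro l2_perp_scale l2_perp_add Q)
    have "l2_normsq M (\<lambda>x. k j x - k i x)
        = l2_normsq M (\<lambda>x. (f x - k i x) - (f x - k j x))"
      by (simp add: algebra_simps)
    also have "\<dots> = 2 * l2_normsq M (\<lambda>x. f x - k i x) + 2 * l2_normsq M (\<lambda>x. f x - k j x)
        - 4 * l2_normsq M (\<lambda>x. 1/2 * ((f x - k i x) + (f x - k j x)))"
      by (intro l2_parallelogram L2_diff f kL)
    also have "(\<lambda>x. 1/2 * ((f x - k i x) + (f x - k j x))) = (\<lambda>x. f x - 1/2 * (k i x + k j x))"
      by (simp add: field_simps)
    finally have "l2_normsq M (\<lambda>x. k j x - k i x) \<le> 2 / Suc i + 2 / Suc j"
      using d[OF mid] kd[of i] kd[of j] by simp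
    then show ?thesis
      by (simp add: l2_normsq_def norm_minus_commute)
  qed
  have cauchy: "\<exists>N. \<forall>i\<ge>N. \<forall>j\<ge>N. l2_normsq M (\<lambda>x. k i x - k j x) < e" if e: "e > 0" for e
  proof -
    obtain N where N: "1 / Suc N < e / 4"
      using nat_approx_posE[of "e/4"] e by auto
    have "l2_normsq M (\<lambda>x. k i x - k j x) < e" if "i \<ge> N" "j \<ge> N" for i j
    proof -
      have "1 / Suc i \<le> 1 / Suc N" "1 / Suc j \<le> 1 / Suc N" using that by (auto simp: field_simps)
      then show ?thesis using near[of i j] N by simp
    qed
    then show ?thesis by blast
  qed
  obtain p where p: "p \<in> L2 M" "(\<lambda>n. l2_normsq M (\<lambda>x. k n x - p x)) \<longlonglongrightarrow> 0"
    using L2_complete[OF kL cauchy] by blast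
  have lim: "(\<lambda>n. l2_inner M (k n) h) \<longlonglongrightarrow> l2_inner M p h" if h: "h \<in> L2 M" for h
  proof -
    have "(\<lambda>n. (cmod (l2_inner M (\<lambda>x. k n x - p x) h))\<^sup>2) \<longlonglongrightarrow> 0"
    proof (rule tendsto_sandwich[OF _ _ tendsto_const])
      show "\<forall>\<^sub>F n in sequentially. (cmod (l2_inner M (\<lambda>x. k n x - p x) h))\<^sup>2
          \<le> l2_normsq M (\<lambda>x. k n x - p x) * l2_normsq M h"
        using l2_Cauchy_Schwarz[OF L2_diff[OF kL p(1)] h] by simp
      show "(\<lambda>n. l2_normsq M (\<lambda>x. k n x - p x) * l2_normsq M h) \<longlonglongrightarrow> 0"
        using tendsto_mult_right[OF p(2), of "l2_normsq M h"] by simp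
    qed simp
    then have "(\<lambda>n. sqrt ((cmod (l2_inner M (\<lambda>x. k n x - p x) h))\<^sup>2)) \<longlonglongrightarrow> sqrt 0"
      by (rule tendsto_real_sqrt)
    then have "(\<lambda>n. l2_inner M (k n) h - l2_inner M p h) \<longlonglongrightarrow> 0"
      using l2_inner_diff_left[OF kL p(1) h] by (simp add: tendsto_norm_zero_iff)
    then show ?thesis by (rule LIM_zero_cancel)
  qed
  have "l2_inner M p h = 0" if "h \<in> Q" for h
  proof -
    have "(\<lambda>n. l2_inner M (k n) h) = (\<lambda>n. 0)" using k that by (auto simp: l2_perp_def)
    then show ?thesis
      using lim[of h] that Q LIMSEQ_unique[OF tendsto_const] by fastforce
  qed
  then have "p \<in> l2_perp M Q" using p by (simp add: l2_perp_def)
  moreover have "l2_inner M (\<lambda>x. f x - p x) h = 0" if h: "h \<in> l2_perp M Q" for h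
  proof -
    have hL: "h \<in> L2 M" using h l2_perp_L2 by blast
    have fk: "(\<lambda>x. f x - k n x) \<in> L2 M" for n by (intro L2_diff f kL)
    have bound: "(cmod (l2_inner M (\<lambda>x. f x - k n x) h))\<^sup>2 \<le> 1 / Suc n * l2_normsq M h" for n
    proof -
      have "d \<le> l2_normsq M (\<lambda>x. (f x - k n x) - c * h x)" for c
        using d[OF l2_perp_add[OF Q k[of n] l2_perp_scale[OF h, of c]]] by (simp add: algebra_simps)
      then have "(cmod (l2_inner M (\<lambda>x. f x - k n x) h))\<^sup>2
          \<le> (l2_normsq M (\<lambda>x. f x - k n x) - d) * l2_normsq M h"
        by (rule l2_best_approximation_bound[OF fk hL])
      also have "\<dots> \<le> 1 / Suc n * l2_normsq M h"
        using kd[of n] by (intro mult_right_mono l2_normsq_nonneg) simp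
      finally show ?thesis .
    qed
    have "(\<lambda>n. (cmod (l2_inner M (\<lambda>x. f x - k n x) h))\<^sup>2) \<longlonglongrightarrow> 0"
    proof (rule tendsto_sandwich[OF _ _ tendsto_const])
      show "\<forall>\<^sub>F n in sequentially. (cmod (l2_inner M (\<lambda>x. f x - k n x) h))\<^sup>2 \<le> 1 / Suc n * l2_normsq M h"
        using bound by simp
      show "(\<lambda>n. 1 / Suc n * l2_normsq M h) \<longlonglongrightarrow> 0"
        using tendsto_mult_right[OF LIMSEQ_inverse_real_of_nat, of "l2_normsq M h"]
        by (simp add: inverse_eq_divide)
    qed simp
    moreover have "(\<lambda>n. (cmod (l2_inner M (\<lambda>x. f x - k n x) h))\<^sup>2) \<longlonglongrightarrow> (cmod (l2_inner M f h - l2_inner M p h))\<^sup>2"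
      unfolding l2_inner_diff_left[OF f kL hL] by (intro tendsto_intros lim hL)
    ultimately have "(cmod (l2_inner M f h - l2_inner M p h))\<^sup>2 = 0"
      using LIMSEQ_unique by blast
    then show ?thesis by (simp add: l2_inner_diff_left f p hL)
  qed
  ultimately show ?thesis using that by blast
qed

section \<open>Orthogonal families are countable\<close>

lemma l2_Bessel:
  assumes "finite J" and F: "\<And>i. i \<in> J \<Longrightarrow> F i \<in> L2 M" "\<And>i. i \<in> J \<Longrightarrow> l2_normsq M (F i) > 0"
    and orth: "\<And>i j. i \<in> J \<Longrightarrow> j \<in> J \<Longrightarrow> i \<noteq> j \<Longrightarrow> l2_inner M (F i) (F j) = 0"
    and "h \<in> L2 M"
  shows "(\<Sum>i\<in>J. (cmod (l2_inner M h (F i)))\<^sup>2 / l2_normsq M (F i)) \<le> l2_normsq M h"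
  using assms
proof (induction J arbitrary: h rule: finite_induct)
  case empty
  then show ?case by (simp add: l2_normsq_nonneg)
next
  case (insert j J)
  define c h' where "c = l2_inner M h (F j) / of_real (l2_normsq M (F j))" and "h' x = h x - c * F j x" for x
  have Fj: "F j \<in> L2 M" using insert.prems by simp
  have h': "h' \<in> L2 M" unfolding h'_def using insert.prems Fj by (intro L2_diff L2_scale)
  have same: "l2_inner M h' (F i) = l2_inner M h (F i)" if "i \<in> J" for i
  proof -
    have "l2_inner M (F j) (F i) = 0"
      using insert.prems(3)[of j i] insert.hyps(2) that by auto
    then show ?thesis
      unfolding h'_def using insert.prems that Fj
      by (simp add: l2_inner_diff_left L2_scale l2_inner_scale_left)
  qed
  have "(\<Sum>i\<in>J. (cmod (l2_inner M h' (F i)))\<^sup>2 / l2_normsq M (F i)) \<le> l2_normsq M h'"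
    using insert.prems by (intro insert.IH h') auto
  moreover have "l2_normsq M h' = l2_normsq M h - (cmod (l2_inner M h (F j)))\<^sup>2 / l2_normsq M (F j)"
    unfolding h'_def c_def using insert.prems by (intro l2_normsq_diff_projection) auto
  ultimately show ?case
    using insert.hyps same by simp
qed

lemma countable_nonzero_coefficients:
  assumes F: "\<And>i. i \<in> I \<Longrightarrow> F i \<in> L2 M" "\<And>i. i \<in> I \<Longrightarrow> l2_normsq M (F i) > 0"
    and orth: "\<And>i j. i \<in> I \<Longrightarrow> j \<in> I \<Longrightarrow> i \<noteq> j \<Longrightarrow> l2_inner M (F i) (F j) = 0"
    and h: "h \<in> L2 M"
  shows "countable {i \<in> I. l2_inner M h (F i) \<noteq> 0}"
proof -
  define u where "u i = (cmod (l2_inner M h (F i)))\<^sup>2 / l2_normsq M (F i)" for i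
  have "u summable_on I"
  proof (rule nonneg_bdd_above_summable_on)
    show "bdd_above (sum u ` {J. J \<subseteq> I \<and> finite J})"
    proof (rule bdd_aboveI2)
      fix J assume "J \<in> {J. J \<subseteq> I \<and> finite J}"
      then have J: "finite J" "\<And>i. i \<in> J \<Longrightarrow> i \<in> I" by auto
      show "sum u J \<le> l2_normsq M h"
        unfolding u_def using J F orth h by (intro l2_Bessel) blast+
    qed
  qed (simp add: u_def l2_normsq_nonneg)
  then have "countable {i \<in> I. u i \<noteq> 0}" by (rule summable_countable_real)
  moreover have "{i \<in> I. l2_inner M h (F i) \<noteq> 0} \<subseteq> {i \<in> I. u i \<noteq> 0}"
    using F(2) by (fastforce simp: u_def)
  ultimately show ?thesis by (rule countable_subset[rotated])
qed

text \<open>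
  Separability of \<open>L\<^sup>2\<close>, in the form in which it is used: the indicator functions of countably many
  sets have no common nonzero orthogonal vector.  By Bessel's inequality each indicator function
  meets only countably many members of an orthogonal family.
\<close>

definition countably_total :: "'a measure \<Rightarrow> bool" where
  "countably_total M \<longleftrightarrow> (\<exists>\<A>. countable \<A> \<and> \<A> \<subseteq> sets M \<and>
     (\<forall>f :: 'a \<Rightarrow> complex. integrable M f \<longrightarrow> (\<forall>A\<in>\<A>. set_lebesgue_integral M A f = 0) \<longrightarrow>
        (AE x in M. f x = 0)))"

lemma (in prob_space) countable_orthogonal_family:
  assumes total: "countably_total M"
    and F: "\<And>i. i \<in> I \<Longrightarrow> F i \<in> L2 M" "\<And>i. i \<in> I \<Longrightarrow> l2_normsq M (F i) > 0"
    and orth: "\<And>i j. i \<in> I \<Longrightarrow> j \<in> I \<Longrightarrow> i \<noteq> j \<Longrightarrow> l2_inner M (F i) (F j) = 0"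
  shows "countable I"
proof -
  obtain \<A> where A: "countable \<A>" "\<A> \<subseteq> sets M"
    and tot: "\<forall>f :: 'a \<Rightarrow> complex. integrable M f \<longrightarrow>
      (\<forall>A\<in>\<A>. set_lebesgue_integral M A f = 0) \<longrightarrow> (AE x in M. f x = 0)"
    using total unfolding countably_total_def by (elim exE conjE)
  have ind: "(\<lambda>x. indicator A x :: complex) \<in> L2 M" if "A \<in> \<A>" for A
  proof -
    have "(\<lambda>x. (cmod (indicator A x))\<^sup>2) = (\<lambda>x. indicator A x :: real)"
      by (auto simp: indicator_def fun_eq_iff)
    moreover have "integrable M (\<lambda>x. indicator A x :: real)"
      using that A(2) by (intro integrable_real_indicator) (auto simp: less_top[symmetric])
    ultimately show ?thesis using that A(2) by (auto simp: L2_def subset_iff)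
  qed
  have "\<exists>A\<in>\<A>. l2_inner M (\<lambda>x. indicator A x) (F i) \<noteq> 0" if i: "i \<in> I" for i
  proof (rule ccontr)
    assume no: "\<not> ?thesis"
    have "AE x in M. F i x = 0"
    proof (rule tot[rule_format, OF L2_integrable[OF F(1)[OF i]]])
      fix A assume "A \<in> \<A>"
      then have "l2_inner M (F i) (\<lambda>x. indicator A x) = 0"
        using no l2_inner_commute[of M "F i" "\<lambda>x. indicator A x"] by simp
      moreover have "cnj (indicator A x) = indicator A x" for x
        by (simp add: indicator_def)
      ultimately show "set_lebesgue_integral M A (F i) = 0"
        by (simp add: l2_inner_def set_lebesgue_integral_def scaleR_conv_of_real mult.commute
            of_real_indicator)
    qed
    then show False using l2_normsq_eq_0_iff F i by fastforce
  qed
  then have "I = (\<Union>A\<in>\<A>. {i \<in> I. l2_inner M (\<lambda>x. indicator A x) (F i) \<noteq> 0})" by blast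
  moreover have "countable \<dots>"
    using A(1) countable_nonzero_coefficients[OF F orth ind] by (intro countable_UN) auto
  ultimately show ?thesis by simp
qed

section \<open>Countably many sets suffice to detect a function\<close>

text \<open>
  Stated for preimages, so that it serves both the rectangles of a product and the Borel sets pulled
  back along an isomorphism.
\<close>

lemma set_integral_vanishes_on_generated:
  fixes f :: "'a \<Rightarrow> complex"
  assumes f: "integrable M f" and g [measurable]: "g \<in> measurable M N"
    and G: "sets N = sigma_sets \<Omega> G" "Int_stable G" "G \<subseteq> Pow \<Omega>" "\<Omega> \<in> G"
    and zero: "\<And>B. B \<in> G \<Longrightarrow> set_lebesgue_integral M (g -` B \<inter> space M) f = 0"
    and B: "B \<in> sets N"
  shows "set_lebesgue_integral M (g -` B \<inter> space M) f = 0"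
proof -
  have meas: "g -` A \<inter> space M \<in> sets M" if "A \<in> sigma_sets \<Omega> G" for A
    using that G(1) by (intro measurable_sets[OF g]) simp
  have int: "set_integrable M (g -` A \<inter> space M) f" if "A \<in> sigma_sets \<Omega> G" for A
    using f unfolding set_integrable_def by (intro integrable_mult_indicator meas that)
  have B': "B \<in> sigma_sets \<Omega> G" using B G(1) by simp
  show ?thesis
    using G(2,3) B'
  proof (induction rule: sigma_sets_induct_disjoint)
    case (basic A)
    then show ?case by (rule zero)
  next
    case empty
    then show ?case by (simp add: set_lebesgue_integral_def)
  next
    case (compl A)
    have top: "\<Omega> \<in> sigma_sets \<Omega> G" by (rule sigma_sets_top)
    have co: "\<Omega> - A \<in> sigma_sets \<Omega> G" using compl(1) by (rule sigma_sets.Compl)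
    have "A \<subseteq> \<Omega>" using sigma_sets_into_sp[OF G(3) compl(1)] .
    then have "g -` \<Omega> \<inter> space M = (g -` A \<inter> space M) \<union> (g -` (\<Omega> - A) \<inter> space M)" by auto
    moreover have "set_lebesgue_integral M ((g -` A \<inter> space M) \<union> (g -` (\<Omega> - A) \<inter> space M)) f
      = set_lebesgue_integral M (g -` A \<inter> space M) f + set_lebesgue_integral M (g -` (\<Omega> - A) \<inter> space M) f"
      by (intro set_integral_Un int co compl(1)) auto
    ultimately show ?case using zero[OF G(4)] compl(2) by simp
  next
    case (union A)
    have eq: "g -` (\<Union>i. A i) \<inter> space M = (\<Union>i. g -` A i \<inter> space M)" by auto
    have UN: "(\<Union>i. A i) \<in> sigma_sets \<Omega> G" using union(2) by (intro sigma_sets.Union) auto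
    have "set_lebesgue_integral M (\<Union>i. g -` A i \<inter> space M) f
      = (\<Sum>i. set_lebesgue_integral M (g -` A i \<inter> space M) f)"
    proof (rule lebesgue_integral_countable_add)
      show "g -` A i \<inter> space M \<in> sets M" for i using union(2) by (intro meas) auto
      show "(g -` A i \<inter> space M) \<inter> (g -` A j \<inter> space M) = {}" if "i \<noteq> j" for i j
        using disjoint_family_onD[OF union(1) _ _ that] by blast
      show "set_integrable M (\<Union>i. g -` A i \<inter> space M) f"
        using int[OF UN] unfolding eq .
    qed
    then show ?case unfolding eq using union(3) by simp
  qed
qed

text \<open>
  Stability under intersections is what the monotone class argument above needs; closing a countable
  base under finite intersections keeps it countable.
\<close>

lemma borel_countable_Int_stable_generator:
  obtains G :: "'b :: second_countable_topology set set"
  where "countable G" "Int_stable G" "UNIV \<in> G" "sets borel = sigma_sets UNIV G"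
proof -
  obtain B :: "'b set set" where B: "countable B" "topological_basis B"
    using ex_countable_basis by blast
  define G where "G = Inter ` {F. finite F \<and> F \<subseteq> B}"
  have "countable {F. finite F \<and> F \<subseteq> B}"
    using countable_Collect_finite_subset[OF B(1)] by (simp add: conj_commute)
  then have "countable G" unfolding G_def by (rule countable_image)
  moreover have "Int_stable G"
  proof (rule Int_stableI)
    fix a b assume "a \<in> G" "b \<in> G"
    then obtain F F' where "finite F" "F \<subseteq> B" "a = \<Inter>F" "finite F'" "F' \<subseteq> B" "b = \<Inter>F'"
      by (auto simp: G_def)
    then show "a \<inter> b \<in> G"
      unfolding G_def by (intro image_eqI[of _ _ "F \<union> F'"]) auto
  qed
  moreover have "UNIV \<in> G"
    unfolding G_def by (intro image_eqI[of _ _ "{}"]) auto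
  moreover have "sets borel = sigma_sets UNIV G"
  proof
    have "B \<subseteq> G"
      unfolding G_def by (auto intro!: image_eqI[of _ _ "{_}"])
    then show "sets borel \<subseteq> sigma_sets UNIV G"
      unfolding borel_eq_countable_basis[OF B] by (simp add: sigma_sets_mono')
    have "G \<subseteq> sets borel"
    proof
      fix a assume "a \<in> G"
      then obtain F where "finite F" "F \<subseteq> B" "a = \<Inter>F" by (auto simp: G_def)
      then have "open a" using topological_basis_open[OF B(2)] by (auto intro!: open_Inter)
      then show "a \<in> sets borel" by simp
    qed
    then show "sigma_sets UNIV G \<subseteq> sets borel"
      using sets.sigma_sets_subset[of G borel] by simp
  qed
  ultimately show ?thesis using that by blast
qed

lemma set_integral_cong_null_difference:
  fixes f :: "'a \<Rightarrow> complex"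
  assumes "integrable M f" "A \<in> sets M" "B \<in> sets M" and ae: "AE x in M. x \<in> A \<longleftrightarrow> x \<in> B"
  shows "set_lebesgue_integral M A f = set_lebesgue_integral M B f"
  unfolding set_lebesgue_integral_def
proof (rule integral_cong_AE)
  show "AE x in M. indicat_real A x *\<^sub>R f x = indicat_real B x *\<^sub>R f x"
    using ae by eventually_elim (simp add: indicator_def)
qed (use assms in measurable)

lemma (in sigma_finite_measure) countably_total_if_generated_by_map:
  fixes g :: "'a \<Rightarrow> 'b :: second_countable_topology"
  assumes g: "g \<in> borel_measurable M"
    and gen: "\<And>A. A \<in> sets M \<Longrightarrow> \<exists>B\<in>sets borel. AE x in M. x \<in> A \<longleftrightarrow> g x \<in> B"
  shows "countably_total M"
proof -
  obtain G :: "'b set set" where G: "countable G" "Int_stable G" "UNIV \<in> G" "sets borel = sigma_sets UNIV G"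
    by (rule borel_countable_Int_stable_generator)
  define \<A> where "\<A> = (\<lambda>B. g -` B \<inter> space M) ` G"
  have "G \<subseteq> sets borel" using G(4) by auto
  then have sub: "\<A> \<subseteq> sets M"
    unfolding \<A>_def using measurable_sets[OF g] by auto
  have "AE x in M. f x = 0"
    if f: "integrable M f" and zero: "\<forall>A\<in>\<A>. set_lebesgue_integral M A f = 0" for f :: "'a \<Rightarrow> complex"
  proof (rule density_zero[OF f])
    fix A assume A: "A \<in> sets M"
    then obtain B where B: "B \<in> sets borel" "AE x in M. x \<in> A \<longleftrightarrow> g x \<in> B" using gen by blast
    have "AE x in M. x \<in> A \<longleftrightarrow> x \<in> g -` B \<inter> space M"
      using B(2) AE_space by eventually_elim simp
    then have "set_lebesgue_integral M A f = set_lebesgue_integral M (g -` B \<inter> space M) f"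
      using measurable_sets[OF g B(1)] by (intro set_integral_cong_null_difference f A)
    also have "\<dots> = 0"
    proof (rule set_integral_vanishes_on_generated[OF f g G(4,2) _ G(3) _ B(1)])
      show "set_lebesgue_integral M (g -` C \<inter> space M) f = 0" if "C \<in> G" for C
        using zero that by (auto simp: \<A>_def)
    qed simp
    finally show "set_lebesgue_integral M A f = 0" .
  qed
  moreover have "countable \<A>" unfolding \<A>_def using G(1) by (rule countable_image)
  ultimately show ?thesis unfolding countably_total_def using sub by blast
qed

text \<open>
  The isomorphism with a completed Borel measure on the line, extended by \<open>0\<close> to the discarded null
  set, pulls the Borel sets back to all measurable sets up to null sets.
\<close>

lemma lebesgue_prob_space_countably_total:
  assumes "lebesgue_prob_space M"
  shows "countably_total M"
proof -
  interpret prob_space M using assms by (simp add: lebesgue_prob_space_def)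
  obtain N :: "real measure" and X0 Y0 \<phi> where N: "sets N = sets borel"
    and X0: "X0 \<in> sets M" "emeasure M X0 = 1" and Y0: "Y0 \<in> sets (completion N)"
    and iso: "measure_iso (restrict_space M X0) (restrict_space (completion N) Y0) \<phi>"
    using assms unfolding lebesgue_prob_space_def by (elim conjE exE)
  let ?R = "restrict_space M X0" and ?S = "restrict_space (completion N) Y0"
  have spN: "space N = UNIV" using sets_eq_imp_space_eq[OF N] by simp
  have spR: "space ?R = X0" using sets.sets_into_space[OF X0(1)] by (auto simp: space_restrict_space)
  have spS: "space ?S = Y0" by (auto simp: space_restrict_space spN)
  have setsR: "A \<in> sets ?R \<longleftrightarrow> A \<subseteq> X0 \<and> A \<in> sets M" for A
    using X0(1) sets.sets_into_space[OF X0(1)] by (intro sets_restrict_space_iff) (simp add: Int_absorb2)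
  have setsS: "A \<in> sets ?S \<longleftrightarrow> A \<subseteq> Y0 \<and> A \<in> sets (completion N)" for A
    using Y0 by (intro sets_restrict_space_iff) (simp add: spN)
  have \<phi>: "bij_betw \<phi> X0 Y0" "\<phi> \<in> measurable ?R ?S" "inv_into X0 \<phi> \<in> measurable ?S ?R"
    and dist: "distr ?R ?S \<phi> = ?S"
    using iso unfolding measure_iso_def spR spS by auto
  have pre: "\<phi> -` C \<inter> X0 \<in> sets M" if "C \<in> sets (completion N)" for C
  proof -
    have "C \<inter> Y0 \<in> sets ?S" using that Y0 by (auto simp: setsS)
    from measurable_sets[OF \<phi>(2) this] have "\<phi> -` (C \<inter> Y0) \<inter> X0 \<in> sets M"
      by (simp add: spR setsR)
    moreover have "\<phi> -` (C \<inter> Y0) \<inter> X0 = \<phi> -` C \<inter> X0"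
      using bij_betwE[OF \<phi>(1)] by auto
    ultimately show ?thesis by simp
  qed
  have null: "\<phi> -` C \<inter> X0 \<in> null_sets M" if "C \<in> null_sets N" for C
  proof -
    have C: "C \<in> null_sets (completion N)" using that by (rule null_sets_completionI)
    have CY: "C \<inter> Y0 \<in> sets ?S" using C Y0 by (auto simp: setsS)
    have "emeasure ?R (\<phi> -` (C \<inter> Y0) \<inter> space ?R) = emeasure ?S (C \<inter> Y0)"
      using emeasure_distr[OF \<phi>(2) CY] dist by simp
    also have "\<dots> = emeasure (completion N) (C \<inter> Y0)"
      using Y0 by (intro emeasure_restrict_space) (auto simp: spN)
    also have "\<dots> = 0"
      using null_set_Int2[OF C Y0] by auto
    also have "\<phi> -` (C \<inter> Y0) \<inter> space ?R = \<phi> -` C \<inter> X0"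
      using bij_betwE[OF \<phi>(1)] by (auto simp: spR)
    also have "emeasure ?R (\<phi> -` C \<inter> X0) = emeasure M (\<phi> -` C \<inter> X0)"
      using X0(1) sets.sets_into_space[OF X0(1)] by (intro emeasure_restrict_space) (auto simp: Int_absorb2)
    finally show ?thesis using pre[of C] C by auto
  qed
  have inX0: "AE x in M. x \<in> X0"
    using X0(2) by (subst AE_in_set_eq_1[OF X0(1)]) (simp add: emeasure_eq_measure)
  define g where "g x = (if x \<in> X0 then \<phi> x else 0)" for x
  have "g \<in> borel_measurable M"
  proof (rule measurableI)
    fix B :: "real set" assume "B \<in> sets borel"
    then have "\<phi> -` B \<inter> X0 \<in> sets M" using N by (intro pre) auto
    moreover have "g -` B \<inter> space M = (\<phi> -` B \<inter> X0) \<union> (if 0 \<in> B then space M - X0 else {})"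
      using sets.sets_into_space[OF X0(1)] by (auto simp: g_def split: if_splits)
    ultimately show "g -` B \<inter> space M \<in> sets M" using X0(1) by auto
  qed simp
  moreover have "\<exists>B\<in>sets borel. AE x in M. x \<in> A \<longleftrightarrow> g x \<in> B" if A: "A \<in> sets M" for A
  proof -
    have "inv_into X0 \<phi> -` (A \<inter> X0) \<inter> Y0 \<in> sets ?S"
      using measurable_sets[OF \<phi>(3), of "A \<inter> X0"] A X0(1) by (simp add: setsR spS)
    moreover have "inv_into X0 \<phi> -` (A \<inter> X0) \<inter> Y0 = \<phi> ` (A \<inter> X0)"
      using \<phi>(1) by (force simp: bij_betw_def inv_into_f_f f_inv_into_f)
    ultimately have "\<phi> ` (A \<inter> X0) \<in> sets (completion N)" by (simp add: setsS)
    then obtain C N' P where C: "\<phi> ` (A \<inter> X0) = C \<union> P" "P \<subseteq> N'" "N' \<in> null_sets N" "C \<in> sets N"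
      by (rule sets_completionE)
    have "AE x in M. x \<in> A \<longleftrightarrow> g x \<in> C"
      using AE_not_in[OF null[OF C(3)]] inX0
    proof eventually_elim
      case (elim x)
      then have x: "x \<in> X0" "\<phi> x \<notin> N'" by auto
      have "x \<in> A \<longleftrightarrow> \<phi> x \<in> \<phi> ` (A \<inter> X0)"
        using \<phi>(1) x(1) by (auto simp: bij_betw_def inj_on_def)
      also have "\<dots> \<longleftrightarrow> \<phi> x \<in> C" using C(1,2) x(2) by auto
      finally show ?case using x(1) by (simp add: g_def)
    qed
    then show ?thesis using C(4) N by auto
  qed
  ultimately show ?thesis by (rule countably_total_if_generated_by_map)
qed

lemma countably_total_pair:
  assumes "prob_space M" "prob_space N" "countably_total M" "countably_total N"
  shows "countably_total (M \<Otimes>\<^sub>M N)"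
proof -
  interpret M: prob_space M by fact
  interpret N: prob_space N by fact
  interpret P: pair_prob_space M N ..
  obtain \<A> where A: "countable \<A>" "\<A> \<subseteq> sets M"
    and totA: "\<forall>f :: 'a \<Rightarrow> complex. integrable M f \<longrightarrow>
      (\<forall>A\<in>\<A>. set_lebesgue_integral M A f = 0) \<longrightarrow> (AE x in M. f x = 0)"
    using assms(3) unfolding countably_total_def by (elim exE conjE)
  obtain \<B> where B: "countable \<B>" "\<B> \<subseteq> sets N"
    and totB: "\<forall>f :: 'b \<Rightarrow> complex. integrable N f \<longrightarrow>
      (\<forall>A\<in>\<B>. set_lebesgue_integral N A f = 0) \<longrightarrow> (AE x in N. f x = 0)"
    using assms(4) unfolding countably_total_def by (elim exE conjE)
  define \<C> where "\<C> = (\<lambda>(A, B). A \<times> B) ` (\<A> \<times> \<B>)"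
  have "countable \<C>" unfolding \<C>_def using A(1) B(1) by (intro countable_image countable_SIGMA)
  moreover have "\<C> \<subseteq> sets (M \<Otimes>\<^sub>M N)" using A(2) B(2) by (auto simp: \<C>_def)
  moreover have "AE z in M \<Otimes>\<^sub>M N. f z = 0"
    if f: "integrable (M \<Otimes>\<^sub>M N) f" and zero: "\<forall>C\<in>\<C>. set_lebesgue_integral (M \<Otimes>\<^sub>M N) C f = 0"
    for f :: "'a \<times> 'b \<Rightarrow> complex"
  proof -
    let ?I = "\<lambda>A B. set_lebesgue_integral (M \<Otimes>\<^sub>M N) (A \<times> B) f"
    let ?F = "\<lambda>A B (x, y). indicat_real A x *\<^sub>R (indicat_real B y *\<^sub>R f (x, y))"
    have int: "integrable (M \<Otimes>\<^sub>M N) (?F A B)" if "A \<in> sets M" "B \<in> sets N" for A B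
    proof -
      have "integrable (M \<Otimes>\<^sub>M N) (\<lambda>z. indicat_real (A \<times> B) z *\<^sub>R f z)"
        using that by (intro integrable_mult_indicator f) simp
      then show ?thesis by (rule Bochner_Integration.integrable_cong[THEN iffD1, rotated 2])
          (auto simp: indicator_def)
    qed
    have I: "?I A B = integral\<^sup>L (M \<Otimes>\<^sub>M N) (?F A B)" for A B
      unfolding set_lebesgue_integral_def
      by (intro Bochner_Integration.integral_cong) (auto simp: indicator_def)
    have I0: "?I A B = 0" if "A \<in> \<A>" "B \<in> \<B>" for A B
      using zero that by (auto simp: \<C>_def)
    \<comment> \<open>Fubini upgrades the hypothesis to all rectangles, one factor at a time.\<close>
    have I1: "?I A B = 0" if A': "A \<in> sets M" and B': "B \<in> \<B>" for A B
    proof -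
      define h where "h x = (\<integral>y. indicat_real B y *\<^sub>R f (x, y) \<partial>N)" for x
      have BN: "B \<in> sets N" using B' B(2) by blast
      have "integrable (M \<Otimes>\<^sub>M N) (\<lambda>(x, y). indicat_real B y *\<^sub>R f (x, y))"
        using int[OF sets.top BN]
        by (rule Bochner_Integration.integrable_cong[THEN iffD1, rotated 2])
          (auto simp: space_pair_measure)
      then have hint: "integrable M h"
        unfolding h_def by (rule P.integrable_fst)
      have Ih: "?I A' B = set_lebesgue_integral M A' h" if "A' \<in> sets M" for A'
      proof -
        have "?I A' B = (\<integral>x. \<integral>y. indicat_real A' x *\<^sub>R (indicat_real B y *\<^sub>R f (x, y)) \<partial>N \<partial>M)"
          unfolding I by (rule P.integral_fst[OF int[OF that BN], symmetric])
        also have "\<dots> = set_lebesgue_integral M A' h"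
          unfolding set_lebesgue_integral_def h_def by (simp only: integral_scaleR_right)
        finally show ?thesis .
      qed
      have "AE x in M. h x = 0"
        using totA hint Ih I0 B' A(2) by (metis subsetD)
      then have "set_lebesgue_integral M A h = set_lebesgue_integral M A (\<lambda>_. 0)"
        using hint A' by (intro set_lebesgue_integral_cong_AE) auto
      then show ?thesis using Ih[OF A'] by simp
    qed
    have I2: "?I A B = 0" if A': "A \<in> sets M" and B': "B \<in> sets N" for A B
    proof -
      define h where "h y = (\<integral>x. indicat_real A x *\<^sub>R f (x, y) \<partial>M)" for y
      have "integrable (M \<Otimes>\<^sub>M N) (\<lambda>(x, y). indicat_real A x *\<^sub>R f (x, y))"
        using int[OF A' sets.top]
        by (rule Bochner_Integration.integrable_cong[THEN iffD1, rotated 2])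
          (auto simp: space_pair_measure)
      then have hint: "integrable N h"
        unfolding h_def by (rule P.integrable_snd)
      have Ih: "?I A B' = set_lebesgue_integral N B' h" if "B' \<in> sets N" for B'
      proof -
        have "?I A B' = (\<integral>y. \<integral>x. indicat_real A x *\<^sub>R (indicat_real B' y *\<^sub>R f (x, y)) \<partial>M \<partial>N)"
          unfolding I by (rule P.integral_snd[OF int[OF A' that], symmetric])
        also have "\<dots> = (\<integral>y. \<integral>x. indicat_real B' y *\<^sub>R (indicat_real A x *\<^sub>R f (x, y)) \<partial>M \<partial>N)"
          by (simp add: mult.commute)
        also have "\<dots> = set_lebesgue_integral N B' h"
          unfolding set_lebesgue_integral_def h_def by (simp only: integral_scaleR_right)
        finally show ?thesis .
      qed
      have "AE y in N. h y = 0"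
        using totB hint Ih I1[OF A'] B(2) by (metis subsetD)
      then have "set_lebesgue_integral N B h = set_lebesgue_integral N B (\<lambda>_. 0)"
        using hint B' by (intro set_lebesgue_integral_cong_AE) auto
      then show ?thesis using Ih[OF B'] by simp
    qed
    show ?thesis
    proof (rule P.density_zero[OF f])
      fix C assume C: "C \<in> sets (M \<Otimes>\<^sub>M N)"
      let ?G = "{a \<times> b |a b. a \<in> sets M \<and> b \<in> sets N}"
      have sp: "g -` B \<inter> space (M \<Otimes>\<^sub>M N) = B" if "B \<in> sets (M \<Otimes>\<^sub>M N)" "g = (\<lambda>z. z)" for B g
        using sets.sets_into_space[OF that(1)] that(2) by auto
      have "set_lebesgue_integral (M \<Otimes>\<^sub>M N) ((\<lambda>z. z) -` C \<inter> space (M \<Otimes>\<^sub>M N)) f = 0"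
      proof (rule set_integral_vanishes_on_generated[OF f _ sets_pair_measure Int_stable_pair_measure_generator _ _ _ C])
        show "?G \<subseteq> Pow (space M \<times> space N)" by (rule pair_measure_closed)
        show "space M \<times> space N \<in> ?G" by blast
        fix B assume "B \<in> ?G"
        then obtain a b where ab: "B = a \<times> b" "a \<in> sets M" "b \<in> sets N" by blast
        then have "B \<in> sets (M \<Otimes>\<^sub>M N)" by simp
        then show "set_lebesgue_integral (M \<Otimes>\<^sub>M N) ((\<lambda>z. z) -` B \<inter> space (M \<Otimes>\<^sub>M N)) f = 0"
          unfolding sp[OF _ refl] using I2 ab by simp
      qed simp
      then show "set_lebesgue_integral (M \<Otimes>\<^sub>M N) C f = 0"
        unfolding sp[OF C refl] .
    qed
  qed
  ultimately show ?thesis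
    unfolding countably_total_def by (intro exI[of _ \<C>] conjI allI impI) auto
qed

section \<open>Directional eigenspaces\<close>

text \<open>The character with frequency \<open>l\<close>, spelled exactly as in \<open>eigenfunction_at\<close>.\<close>

abbreviation wave :: "real ^ 'n \<Rightarrow> real ^ 'n \<Rightarrow> complex" where
  "wave l t \<equiv> exp (2 * of_real pi * \<i> * of_real (l \<bullet> t))"

lemma wave_eq_cis: "wave l t = cis (2 * pi * (l \<bullet> t))"
  by (simp add: cis_conv_exp mult_ac)

lemma wave_add: "wave l (s + t) = wave l s * wave l t"
  unfolding wave_eq_cis by (simp add: cis_mult inner_add_right distrib_left)

lemma wave_mult_cnj: "wave l t * cnj (wave l t) = 1"
  unfolding wave_eq_cis by (simp add: complex_norm_square[symmetric])

text \<open>Equality of the phases only gives \<open>l \<bullet> t - l' \<bullet> t \<in> \<int>\<close>; scaling \<open>t\<close> removes the ambiguity.\<close>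

lemma wave_eq_on_line_imp_inner_eq:
  assumes eq: "\<And>r. wave l (r *\<^sub>R t) = wave l' (r *\<^sub>R t)"
  shows "l \<bullet> t = l' \<bullet> t"
proof (rule ccontr)
  define a where "a = l \<bullet> t - l' \<bullet> t"
  assume "l \<bullet> t \<noteq> l' \<bullet> t"
  then have a: "a \<noteq> 0" by (simp add: a_def)
  \<comment> \<open>At half a period of the difference the two phases are opposite.\<close>
  let ?t = "(1 / (2 * a)) *\<^sub>R t"
  have "1 = wave l ?t * cnj (wave l' ?t)"
    using eq wave_mult_cnj by metis
  also have "\<dots> = cis (2 * pi * (l \<bullet> ?t) - 2 * pi * (l' \<bullet> ?t))"
    unfolding wave_eq_cis by (simp add: cis_cnj cis_mult)
  also have "2 * pi * (l \<bullet> ?t) - 2 * pi * (l' \<bullet> ?t) = 2 * pi * (1 / (2 * a)) * a"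
    unfolding a_def inner_scaleR_right by (simp only: right_diff_distrib mult.assoc)
  also have "\<dots> = pi" using a by simp
  finally show False by simp
qed

text \<open>
  Eigenfunctions are sought in the orthogonal complement of \<open>Q\<close>.  Invariance of \<open>Q\<close> under the flow makes
  this complement invariant, so that projections stay inside it.
\<close>

locale l2_flow = prob_space M
  for M :: "'a measure" +
  fixes S :: "real ^ 'n \<Rightarrow> 'a \<Rightarrow> 'a" and Q :: "('a \<Rightarrow> complex) set"
  assumes action: "mp_action M S"
    and total: "countably_total M"
    and Q_L2: "Q \<subseteq> L2 M"
    and Q_invariant: "\<And>G t. G \<in> Q \<Longrightarrow> (\<lambda>x. G (S t x)) \<in> Q"
begin

lemma S_measurable [measurable]: "S t \<in> measurable M M"
  and S_distr: "distr M M (S t) = M"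
  using action by (auto simp: mp_action_def)

lemma S_S: "x \<in> space M \<Longrightarrow> S s (S t x) = S (s + t) x"
  and S_0: "x \<in> space M \<Longrightarrow> S 0 x = x"
  using action by (auto simp: mp_action_def)

lemma AE_S: "(AE x in M. P x) \<Longrightarrow> AE x in M. P (S t x)"
  by (rule AE_distrD[OF S_measurable]) (simp only: S_distr)

lemma L2_S: "f \<in> L2 M \<Longrightarrow> (\<lambda>x. f (S t x)) \<in> L2 M"
proof -
  assume f: "f \<in> L2 M"
  then have [measurable]: "f \<in> borel_measurable M" by (rule L2_measurable)
  have "integrable (distr M M (S t)) (\<lambda>x. (cmod (f x))\<^sup>2)"
    unfolding S_distr using f by (rule L2_integrable_normsq)
  then have "integrable M (\<lambda>x. (cmod (f (S t x)))\<^sup>2)"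
    by (rule integrable_distr[OF S_measurable])
  then show ?thesis by (simp add: L2_def)
qed

lemma l2_inner_S:
  assumes "f \<in> L2 M" "g \<in> L2 M"
  shows "l2_inner M (\<lambda>x. f (S t x)) g = l2_inner M f (\<lambda>x. g (S (- t) x))"
proof -
  have "l2_inner M f (\<lambda>x. g (S (- t) x)) = l2_inner (distr M M (S t)) f (\<lambda>x. g (S (- t) x))"
    by (simp add: S_distr)
  also have "\<dots> = (\<integral>x. f (S t x) * cnj (g (S (- t) (S t x))) \<partial>M)"
    unfolding l2_inner_def using L2_mult_integrable[OF assms(1) L2_S[OF assms(2), of "- t"]]
    by (intro integral_distr) auto
  also have "\<dots> = l2_inner M (\<lambda>x. f (S t x)) g"
    unfolding l2_inner_def by (intro Bochner_Integration.integral_cong refl) (simp add: S_S S_0)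
  finally show ?thesis by simp
qed

definition eigenspace :: "(real ^ 'n) set \<Rightarrow> real ^ 'n \<Rightarrow> ('a \<Rightarrow> complex) set" where
  "eigenspace L l = {F \<in> l2_perp M Q. \<forall>t\<in>L. AE y in M. F (S t y) = wave l t * F y}"

definition eigenspace_tests :: "(real ^ 'n) set \<Rightarrow> real ^ 'n \<Rightarrow> ('a \<Rightarrow> complex) set" where
  "eigenspace_tests L l =
     Q \<union> {(\<lambda>x. h (S (- t) x) - cnj (wave l t) * h x) |h t. h \<in> L2 M \<and> t \<in> L}"

lemma eigenspace_L2: "F \<in> eigenspace L l \<Longrightarrow> F \<in> L2 M"
  by (simp add: eigenspace_def l2_perp_def)

lemma eigenspace_tests_L2: "eigenspace_tests L l \<subseteq> L2 M"
  using Q_L2 by (auto simp: eigenspace_tests_def intro!: L2_diff L2_scale L2_S)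

text \<open>
  Moving the flow to the other side of the inner product writes an eigenspace as an orthogonal
  complement, the form to which the projection theorem applies.
\<close>

lemma eigenspace_eq_perp: "eigenspace L l = l2_perp M (eigenspace_tests L l)"
proof (intro subset_antisym subsetI)
  have adj: "l2_inner M F (\<lambda>x. h (S (- t) x) - cnj (wave l t) * h x)
      = l2_inner M (\<lambda>x. F (S t x) - wave l t * F x) h"
    if "F \<in> L2 M" "h \<in> L2 M" for F h t
    using that by (simp add: l2_inner_diff_left l2_inner_diff_right L2_S L2_scale l2_inner_S
        l2_inner_scale_left l2_inner_scale_right)
  {
    fix F assume F: "F \<in> eigenspace L l"
    then have FL: "F \<in> L2 M" by (rule eigenspace_L2)
    have "l2_inner M F (\<lambda>x. h (S (- t) x) - cnj (wave l t) * h x) = 0"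
      if "h \<in> L2 M" "t \<in> L" for h t
    proof -
      have "AE y in M. F (S t y) = wave l t * F y"
        using F that(2) by (simp add: eigenspace_def)
      then have "AE y in M. F (S t y) - wave l t * F y = 0"
        by eventually_elim simp
      then have "l2_inner M (\<lambda>x. F (S t x) - wave l t * F x) h = l2_inner M (\<lambda>_. 0) h"
        by (rule l2_inner_cong_AE[OF _ L2_diff[OF L2_S[OF FL] L2_scale[OF FL]] L2_const that(1)])
      then show ?thesis unfolding adj[OF FL that(1)] by (simp add: l2_inner_def)
    qed
    then show "F \<in> l2_perp M (eigenspace_tests L l)"
      using F by (auto simp: eigenspace_def l2_perp_def eigenspace_tests_def)
  next
    fix F assume F: "F \<in> l2_perp M (eigenspace_tests L l)"
    then have FL: "F \<in> L2 M" by (simp add: l2_perp_def)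
    have "AE y in M. F (S t y) = wave l t * F y" if t: "t \<in> L" for t
    proof -
      define h where "h x = F (S t x) - wave l t * F x" for x
      have h: "h \<in> L2 M" unfolding h_def by (rule L2_diff[OF L2_S[OF FL] L2_scale[OF FL]])
      have "(\<lambda>x. h (S (- t) x) - cnj (wave l t) * h x) \<in> eigenspace_tests L l"
        using h t by (auto simp: eigenspace_tests_def)
      then have "l2_inner M F (\<lambda>x. h (S (- t) x) - cnj (wave l t) * h x) = 0"
        using F by (simp add: l2_perp_def)
      then have "l2_inner M h h = 0"
        unfolding adj[OF FL h] h_def[symmetric] .
      then have "AE x in M. h x = 0"
        unfolding l2_inner_self using l2_normsq_eq_0_iff[OF h] by simp
      then show ?thesis by eventually_elim (simp add: h_def)
    qed
    then show "F \<in> eigenspace L l"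
      using F by (auto simp: eigenspace_def l2_perp_def eigenspace_tests_def)
  }
qed

lemma eigenspace_diff: "F \<in> eigenspace L l \<Longrightarrow> G \<in> eigenspace L l \<Longrightarrow> (\<lambda>x. F x - G x) \<in> eigenspace L l"
  unfolding eigenspace_eq_perp by (rule l2_perp_diff[OF eigenspace_tests_L2])

lemma eigenspace_scale: "F \<in> eigenspace L l \<Longrightarrow> (\<lambda>x. c * F x) \<in> eigenspace L l"
  unfolding eigenspace_eq_perp by (rule l2_perp_scale)

lemma perp_invariant: "F \<in> l2_perp M Q \<Longrightarrow> (\<lambda>x. F (S t x)) \<in> l2_perp M Q"
  using Q_L2 Q_invariant[of _ "- t"] by (auto simp: l2_perp_def L2_S l2_inner_S subset_iff)

lemma eigenspace_invariant:
  assumes F: "F \<in> eigenspace L l"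
  shows "(\<lambda>x. F (S s x)) \<in> eigenspace L l"
proof -
  have "AE y in M. F (S s (S t y)) = wave l t * F (S s y)" if "t \<in> L" for t
  proof -
    have "AE y in M. F (S t y) = wave l t * F y" using F that by (simp add: eigenspace_def)
    from AE_S[OF this, of s] AE_space show ?thesis
      by eventually_elim (simp add: S_S add.commute)
  qed
  then show ?thesis using F perp_invariant by (simp add: eigenspace_def)
qed

text \<open>
  The acting group is abelian, so the flow preserves each eigenspace and commutes with the
  orthogonal projection onto it.  Therefore that projection maps every other eigenspace into itself.
\<close>

lemma eigenspace_projection:
  assumes f: "f \<in> eigenspace L' l'"
  obtains p where "p \<in> eigenspace L l" "p \<in> eigenspace L' l'"
    "\<And>k. k \<in> eigenspace L l \<Longrightarrow> l2_inner M (\<lambda>x. f x - p x) k = 0"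
proof -
  have fL: "f \<in> L2 M" using f by (rule eigenspace_L2)
  obtain p where p: "p \<in> eigenspace L l"
    and orth: "\<And>k. k \<in> eigenspace L l \<Longrightarrow> l2_inner M (\<lambda>x. f x - p x) k = 0"
    using l2_projection_exists[OF eigenspace_tests_L2 fL] unfolding eigenspace_eq_perp by blast
  have pL: "p \<in> L2 M" using p by (rule eigenspace_L2)
  have "AE y in M. p (S s y) = wave l' s * p y" if s: "s \<in> L'" for s
  proof -
    define k where "k x = p (S s x) - wave l' s * p x" for x
    have k: "k \<in> eigenspace L l"
      unfolding k_def by (intro eigenspace_diff eigenspace_scale eigenspace_invariant p)
    then have kL: "k \<in> L2 M" by (rule eigenspace_L2)
    have "l2_inner M (\<lambda>x. f (S s x) - p (S s x)) k = l2_inner M (\<lambda>x. f x - p x) (\<lambda>x. k (S (- s) x))"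
      using l2_inner_S[OF L2_diff[OF fL pL] kL] .
    also have "\<dots> = 0" using orth eigenspace_invariant[OF k] by blast
    finally have 1: "l2_inner M (\<lambda>x. f (S s x)) k = l2_inner M (\<lambda>x. p (S s x)) k"
      using fL pL kL by (simp add: l2_inner_diff_left L2_S)
    have "l2_inner M (\<lambda>x. f (S s x)) k = l2_inner M (\<lambda>x. wave l' s * f x) k"
      using f s by (intro l2_inner_cong_AE[OF _ L2_S[OF fL] L2_scale[OF fL] kL]) (simp add: eigenspace_def)
    also have "\<dots> = wave l' s * l2_inner M p k"
      using orth[OF k] fL pL kL by (simp add: l2_inner_scale_left l2_inner_diff_left)
    finally have "l2_inner M k k = 0"
      using 1 pL kL unfolding k_def
      by (subst l2_inner_diff_left) (auto simp: L2_S L2_scale l2_inner_scale_left k_def[symmetric])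
    then have "AE x in M. k x = 0"
      unfolding l2_inner_self using l2_normsq_eq_0_iff[OF kL] by simp
    then show ?thesis by eventually_elim (simp add: k_def)
  qed
  then have "p \<in> eigenspace L' l'"
    using p by (simp add: eigenspace_def)
  then show ?thesis using that p orth by blast
qed

text \<open>A nonzero function can only be multiplied by one phase, and \<open>L \<inter> L'\<close> contains whole lines.\<close>

lemma eigenspaces_agree:
  assumes "subspace L" "subspace L'" and p: "p \<in> eigenspace L l" "p \<in> eigenspace L' l'"
    and nz: "\<not> (AE y in M. p y = 0)" and t: "t \<in> L" "t \<in> L'"
  shows "l \<bullet> t = l' \<bullet> t"
proof (rule wave_eq_on_line_imp_inner_eq, rule ccontr)
  fix r assume ne: "wave l (r *\<^sub>R t) \<noteq> wave l' (r *\<^sub>R t)"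
  have "r *\<^sub>R t \<in> L" "r *\<^sub>R t \<in> L'"
    using t assms(1,2) by (auto intro: subspace_scale)
  then have "AE y in M. p (S (r *\<^sub>R t) y) = wave l (r *\<^sub>R t) * p y"
    "AE y in M. p (S (r *\<^sub>R t) y) = wave l' (r *\<^sub>R t) * p y"
    using p unfolding eigenspace_def by blast+
  then have "AE y in M. p y = 0"
    by eventually_elim (use ne in auto)
  then show False using nz by simp
qed

lemma eigenspace_glue:
  assumes p: "p \<in> eigenspace L l" "p \<in> eigenspace L' l'"
    and m: "\<And>t. t \<in> L \<Longrightarrow> m \<bullet> t = l \<bullet> t" "\<And>t. t \<in> L' \<Longrightarrow> m \<bullet> t = l' \<bullet> t"
  shows "p \<in> eigenspace (subspace_sum L L') m"
proof -
  have "AE y in M. p (S (s + t) y) = wave m (s + t) * p y" if "s \<in> L" "t \<in> L'" for s t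
  proof -
    have s: "AE y in M. p (S s y) = wave l s * p y" and t: "AE y in M. p (S t y) = wave l' t * p y"
      using p that by (auto simp: eigenspace_def)
    have m': "wave m (s + t) = wave l s * wave l' t"
      unfolding wave_add using m that by simp
    show ?thesis
      unfolding m' using AE_S[OF s, of t] t AE_space
      by eventually_elim (simp add: S_S)
  qed
  then show ?thesis using p by (auto simp: eigenspace_def)
qed

end

text \<open>
  \<open>\<Lambda> L\<close> lists the frequencies admitted in direction \<open>L\<close>: only \<open>0\<close> for invariant functions, all of \<open>L\<close> for
  eigenfunctions.  Restriction to subspaces gives the down-set property, gluing on sums the
  orthogonality of eigenfunctions of distinct maximal directions.
\<close>

definition frequency_family :: "((real ^ 'n) set \<Rightarrow> (real ^ 'n) set) \<Rightarrow> bool" where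
  "frequency_family \<Lambda> \<longleftrightarrow>
     (\<forall>L L'. \<forall>l\<in>\<Lambda> L'. subspace L \<longrightarrow> L \<subseteq> L' \<longrightarrow> (\<exists>m\<in>\<Lambda> L. \<forall>t\<in>L. m \<bullet> t = l \<bullet> t)) \<and>
     (\<forall>L L'. \<forall>l\<in>\<Lambda> L. \<forall>l'\<in>\<Lambda> L'. subspace L \<longrightarrow> subspace L' \<longrightarrow> (\<forall>t\<in>L \<inter> L'. l \<bullet> t = l' \<bullet> t) \<longrightarrow>
        (\<exists>m\<in>\<Lambda> (subspace_sum L L'). (\<forall>t\<in>L. m \<bullet> t = l \<bullet> t) \<and> (\<forall>t\<in>L'. m \<bullet> t = l' \<bullet> t)))"

lemma frequency_family_restrict:
  assumes "frequency_family \<Lambda>" "l \<in> \<Lambda> L'" "subspace L" "L \<subseteq> L'"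
  obtains m where "m \<in> \<Lambda> L" "\<And>t. t \<in> L \<Longrightarrow> m \<bullet> t = l \<bullet> t"
  using assms unfolding frequency_family_def by metis

lemma frequency_family_glue:
  assumes "frequency_family \<Lambda>" "l \<in> \<Lambda> L" "l' \<in> \<Lambda> L'" "subspace L" "subspace L'"
    and "\<And>t. t \<in> L \<Longrightarrow> t \<in> L' \<Longrightarrow> l \<bullet> t = l' \<bullet> t"
  obtains m where "m \<in> \<Lambda> (subspace_sum L L')"
    "\<And>t. t \<in> L \<Longrightarrow> m \<bullet> t = l \<bullet> t" "\<And>t. t \<in> L' \<Longrightarrow> m \<bullet> t = l' \<bullet> t"
proof -
  have "\<exists>m\<in>\<Lambda> (subspace_sum L L'). (\<forall>t\<in>L. m \<bullet> t = l \<bullet> t) \<and> (\<forall>t\<in>L'. m \<bullet> t = l' \<bullet> t)"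
    using assms(1)[unfolded frequency_family_def, THEN conjunct2, rule_format, OF assms(2-5)] assms(6)
    by simp
  then show ?thesis using that by blast
qed

lemma frequency_family_zero: "frequency_family (\<lambda>_. {0})"
  by (simp add: frequency_family_def)

lemma frequency_family_id: "frequency_family (\<lambda>L. L)"
  unfolding frequency_family_def
proof (intro conjI allI ballI impI)
  fix L L' :: "(real ^ 'n) set" and l
  assume "subspace L"
  then obtain m where "m \<in> L" "\<And>t. t \<in> L \<Longrightarrow> m \<bullet> t = l \<bullet> t"
    using frequency_restrict[of L l] by blast
  then show "\<exists>m\<in>L. \<forall>t\<in>L. m \<bullet> t = l \<bullet> t" by blast
next
  fix L L' :: "(real ^ 'n) set" and l l'
  assume "subspace L" "subspace L'" "\<forall>t\<in>L \<inter> L'. l \<bullet> t = l' \<bullet> t"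
  then obtain m where "m \<in> subspace_sum L L'"
    "\<And>t. t \<in> L \<Longrightarrow> m \<bullet> t = l \<bullet> t" "\<And>t. t \<in> L' \<Longrightarrow> m \<bullet> t = l' \<bullet> t"
    using frequency_glue[of L L' l l'] by blast
  then show "\<exists>m\<in>subspace_sum L L'. (\<forall>t\<in>L. m \<bullet> t = l \<bullet> t) \<and> (\<forall>t\<in>L'. m \<bullet> t = l' \<bullet> t)"
    by blast
qed

context l2_flow
begin

definition has_eigenfunction :: "((real ^ 'n) set \<Rightarrow> (real ^ 'n) set) \<Rightarrow> (real ^ 'n) set \<Rightarrow> bool" where
  "has_eigenfunction \<Lambda> L \<longleftrightarrow> (\<exists>l\<in>\<Lambda> L. \<exists>F\<in>eigenspace L l. \<not> (AE y in M. F y = 0))"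

lemma has_eigenfunction_subspace:
  assumes "frequency_family \<Lambda>" "has_eigenfunction \<Lambda> L'" "subspace L" "L \<subseteq> L'"
  shows "has_eigenfunction \<Lambda> L"
proof -
  obtain l F where l: "l \<in> \<Lambda> L'" and F: "F \<in> eigenspace L' l" "\<not> (AE y in M. F y = 0)"
    using assms(2) by (auto simp: has_eigenfunction_def)
  obtain m where m: "m \<in> \<Lambda> L" "\<And>t. t \<in> L \<Longrightarrow> m \<bullet> t = l \<bullet> t"
    using frequency_family_restrict[OF assms(1) l assms(3,4)] by blast
  have "F \<in> eigenspace L m"
    using F(1) m(2) assms(4) by (auto simp: eigenspace_def)
  then show ?thesis using m(1) F(2) by (auto simp: has_eigenfunction_def)
qed

text \<open>
  If two eigenfunctions are not orthogonal, the projection of one onto the eigenspace of the other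
  is a nonzero eigenfunction for both directions, hence for their sum.
\<close>

lemma eigenfunctions_orthogonal:
  assumes \<Lambda>: "frequency_family \<Lambda>" and L: "subspace L" "subspace L'"
    and l: "l \<in> \<Lambda> L" "l' \<in> \<Lambda> L'" and F: "F \<in> eigenspace L l" "F' \<in> eigenspace L' l'"
    and no: "\<not> has_eigenfunction \<Lambda> (subspace_sum L L')"
  shows "l2_inner M F' F = 0"
proof -
  obtain p where p: "p \<in> eigenspace L l" "p \<in> eigenspace L' l'"
    and orth: "l2_inner M (\<lambda>x. F' x - p x) F = 0"
    using eigenspace_projection[OF F(2), of L l] F(1) by blast
  have L2: "p \<in> L2 M" "F \<in> L2 M" "F' \<in> L2 M"
    using p F by (auto intro: eigenspace_L2)
  have p0: "AE y in M. p y = 0"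
  proof (rule ccontr)
    assume nz: "\<not> (AE y in M. p y = 0)"
    obtain m where m: "m \<in> \<Lambda> (subspace_sum L L')"
      "\<And>t. t \<in> L \<Longrightarrow> m \<bullet> t = l \<bullet> t" "\<And>t. t \<in> L' \<Longrightarrow> m \<bullet> t = l' \<bullet> t"
      using frequency_family_glue[OF \<Lambda> l L eigenspaces_agree[OF L p nz]] by blast
    have "p \<in> eigenspace (subspace_sum L L') m"
      by (rule eigenspace_glue[OF p m(2,3)])
    then have "has_eigenfunction \<Lambda> (subspace_sum L L')"
      using m(1) nz unfolding has_eigenfunction_def by blast
    then show False using no by simp
  qed
  have "l2_inner M p F = l2_inner M (\<lambda>_. 0) F"
    by (intro l2_inner_cong_AE p0 L2 L2_const)
  then show ?thesis
    using orth L2 by (simp add: l2_inner_diff_left) (simp add: l2_inner_def)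
qed

text \<open>
  Eigenfunctions chosen for the maximal directions form an orthogonal family, since the sum of two
  distinct maximal directions is larger than both.  The zero subspace belongs to the complement by
  convention, with no eigenfunction attached, and is treated separately.
\<close>

theorem ex1_structure_set_eigenfunction:
  assumes \<Lambda>: "frequency_family \<Lambda>"
  shows "\<exists>!\<N>. structure_set {L \<in> directions. \<not> has_eigenfunction \<Lambda> L} \<N>" (is "\<exists>!\<N>. structure_set ?D \<N>")
proof (rule ex1_structure_set)
  fix L L' :: "(real ^ 'n) set"
  assume "L' \<in> grassmannians - ?D" "subspace L" "L \<subseteq> L'"
  then show "L \<notin> ?D"
    using has_eigenfunction_subspace[OF \<Lambda>, of L' L] subspace_0[of L]
    by (auto simp: subspace_iff_grassmannians directions_iff)
next
  define \<X> where "\<X> = maximal_members (grassmannians - ?D) - {{0}}"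
  have X: "subspace L \<and> has_eigenfunction \<Lambda> L" if "L \<in> \<X>" for L
    using that by (auto simp: \<X>_def maximal_members_def subspace_iff_grassmannians directions_iff)
  then have "\<forall>L\<in>\<X>. \<exists>l F. l \<in> \<Lambda> L \<and> F \<in> eigenspace L l \<and> \<not> (AE y in M. F y = 0)"
    unfolding has_eigenfunction_def by blast
  then obtain l F where F: "\<And>L. L \<in> \<X> \<Longrightarrow> l L \<in> \<Lambda> L \<and> F L \<in> eigenspace L (l L) \<and> \<not> (AE y in M. F L y = 0)"
    by metis
  have maxi: "L = V" if "L \<in> \<X>" "V \<in> grassmannians - ?D" "L \<subseteq> V" for L V
    using that unfolding \<X>_def maximal_members_def by blast
  have sum: "\<not> has_eigenfunction \<Lambda> (subspace_sum L L')" if LX: "L \<in> \<X>" "L' \<in> \<X>" "L \<noteq> L'" for L L'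
  proof
    assume has: "has_eigenfunction \<Lambda> (subspace_sum L L')"
    have sub: "subspace L" "subspace L'" using X LX by auto
    then have V: "subspace_sum L L' \<in> grassmannians - ?D"
      using has by (simp add: subspace_iff_grassmannians subspace_sums)
    have "L \<subseteq> subspace_sum L L'" "L' \<subseteq> subspace_sum L L'"
      using subspace_0[OF sub(1)] subspace_0[OF sub(2)] by force+
    from maxi[OF LX(1) V this(1)] maxi[OF LX(2) V this(2)] have "L = L'"
      by (rule trans[OF _ sym])
    with LX(3) show False ..
  qed
  have "countable \<X>"
  proof (rule countable_orthogonal_family[OF total])
    fix L assume "L \<in> \<X>"
    then show "F L \<in> L2 M" "l2_normsq M (F L) > 0"
      using F[of L] eigenspace_L2 l2_normsq_eq_0_iff[of "F L" M] l2_normsq_nonneg[of M "F L"]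
      by (auto simp: less_le)
  next
    fix L L' assume "L \<in> \<X>" "L' \<in> \<X>" "L \<noteq> L'"
    then show "l2_inner M (F L) (F L') = 0"
      using F X sum[of L' L] by (intro eigenfunctions_orthogonal[OF \<Lambda>]) auto
  qed
  then show "countable (maximal_members (grassmannians - ?D))"
    by (simp add: \<X>_def)
qed

lemma has_eigenfunction_iff:
  "has_eigenfunction \<Lambda> L \<longleftrightarrow> (\<exists>F\<in>l2_perp M Q. \<exists>l\<in>\<Lambda> L. eigenfunction_at M S L l F)"
  by (auto simp: has_eigenfunction_def eigenspace_def eigenfunction_at_def l2_perp_def)

end

section \<open>Flows and functions of mean zero\<close>

lemma l2_flow_constants:
  assumes "lebesgue_prob_space M" "mp_action M T"
  shows "l2_flow M T (range (\<lambda>c _. c))"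
proof -
  interpret prob_space M using assms(1) by (simp add: lebesgue_prob_space_def)
  show ?thesis
    using assms lebesgue_prob_space_countably_total by unfold_locales (auto simp: L2_const)
qed

locale mean_zero_flow = l2_flow M S "range (\<lambda>c _. c)" for M S
begin

lemma perp_iff_integral_zero: "F \<in> l2_perp M (range (\<lambda>c _. c)) \<longleftrightarrow> F \<in> L2 M \<and> (\<integral>x. F x \<partial>M) = 0"
proof -
  have "l2_inner M F (\<lambda>_. c) = (\<integral>x. F x \<partial>M) * cnj c" if "F \<in> L2 M" for c
    unfolding l2_inner_def using L2_integrable[OF that] by simp
  then show ?thesis by (auto simp: l2_perp_def dest: spec[of _ 1])
qed

text \<open>
  The mean of an eigenfunction is multiplied by the phase under the flow and preserved by it, so
  subtracting the mean leaves an eigenfunction of the same frequency.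
\<close>

lemma nonconstant_eigenfunction_iff:
  "(\<exists>F\<in>L2 M. (\<forall>t\<in>L. AE y in M. F (S t y) = wave l t * F y) \<and> \<not> ae_constant M F)
    \<longleftrightarrow> (\<exists>F\<in>eigenspace L l. \<not> (AE y in M. F y = 0))"
proof (intro iffI; elim bexE conjE)
  fix F assume F: "F \<in> L2 M" and eig: "\<forall>t\<in>L. AE y in M. F (S t y) = wave l t * F y"
    and nc: "\<not> ae_constant M F"
  define m where "m = (\<integral>x. F x \<partial>M)"
  define F' where "F' x = F x - m" for x
  have F': "F' \<in> L2 M" unfolding F'_def by (intro L2_diff F L2_const)
  have "(\<integral>x. F' x \<partial>M) = 0"
    unfolding F'_def using L2_integrable[OF F] by (simp add: m_def prob_space)
  moreover have "AE y in M. F' (S t y) = wave l t * F' y" if t: "t \<in> L" for t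
  proof -
    have Ft: "AE y in M. F (S t y) = wave l t * F y" using eig t by blast
    have "m = (\<integral>x. F x \<partial>distr M M (S t))" by (simp add: m_def S_distr)
    also have "\<dots> = (\<integral>x. F (S t x) \<partial>M)" using F by (intro integral_distr) (auto simp: L2_measurable)
    also have "\<dots> = (\<integral>x. wave l t * F x \<partial>M)"
      using Ft L2_measurable[OF L2_S[OF F]] L2_measurable[OF L2_scale[OF F]] by (intro integral_cong_AE)
    also have "\<dots> = wave l t * m" using L2_integrable[OF F] by (simp add: m_def)
    finally have m: "wave l t * m = m" by simp
    show ?thesis
      using Ft by eventually_elim (simp add: F'_def right_diff_distrib m)
  qed
  ultimately have "F' \<in> eigenspace L l"
    using F' by (simp add: eigenspace_def perp_iff_integral_zero)
  moreover have "\<not> (AE y in M. F' y = 0)"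
    using nc by (auto simp: F'_def ae_constant_def)
  ultimately show "\<exists>F\<in>eigenspace L l. \<not> (AE y in M. F y = 0)" by blast
next
  fix F assume F: "F \<in> eigenspace L l" and nz: "\<not> (AE y in M. F y = 0)"
  have FL: "F \<in> L2 M" using F by (rule eigenspace_L2)
  have "\<not> ae_constant M F"
  proof
    assume "ae_constant M F"
    then obtain c where c: "AE x in M. F x = c" by (auto simp: ae_constant_def)
    then have "(\<integral>x. F x \<partial>M) = (\<integral>x. c \<partial>M)"
      using L2_measurable[OF FL] by (intro integral_cong_AE) auto
    moreover have "(\<integral>x. F x \<partial>M) = 0"
      using F by (simp add: eigenspace_def perp_iff_integral_zero)
    ultimately show False using c nz by (simp add: prob_space)
  qed
  then show "\<exists>F\<in>L2 M. (\<forall>t\<in>L. AE y in M. F (S t y) = wave l t * F y) \<and> \<not> ae_constant M F"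
    using F FL by (auto simp: eigenspace_def)
qed

lemma ergodic_dirs_eq: "rd_ergodic_dirs M S = {L \<in> directions. \<not> has_eigenfunction (\<lambda>_. {0}) L}"
proof -
  have "ergodic_on M S L \<longleftrightarrow> \<not> has_eigenfunction (\<lambda>_. {0}) L" for L
    using nonconstant_eigenfunction_iff[of L 0] by (auto simp: ergodic_on_def has_eigenfunction_def)
  then show ?thesis by (simp add: rd_ergodic_dirs_def)
qed

lemma weak_mixing_dirs_eq: "rd_weak_mixing_dirs M S = {L \<in> directions. \<not> has_eigenfunction (\<lambda>L. L) L}"
proof -
  have "\<not> ae_constant M F \<Longrightarrow> \<not> (AE y in M. F y = 0)" for F
    by (auto simp: ae_constant_def)
  then have "weak_mixing_on M S L \<longleftrightarrow>
      \<not> (\<exists>l\<in>L. \<exists>F\<in>L2 M. (\<forall>t\<in>L. AE y in M. F (S t y) = wave l t * F y) \<and> \<not> ae_constant M F)" for L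
    unfolding weak_mixing_on_def dir_eigenfunction_def eigenfunction_at_def by blast
  then show ?thesis
    unfolding nonconstant_eigenfunction_iff by (simp add: rd_weak_mixing_dirs_def has_eigenfunction_def)
qed

end

section \<open>Rotations of the unit cube\<close>

definition int_vec :: "int ^ 'n \<Rightarrow> real ^ 'n" where
  "int_vec k = (\<chi> i. of_int (k $ i))"

definition floor_vec :: "real ^ 'n \<Rightarrow> int ^ 'n" where
  "floor_vec v = (\<chi> i. \<lfloor>v $ i\<rfloor>)"

definition frac_vec :: "real ^ 'n \<Rightarrow> real ^ 'n" where
  "frac_vec v = (\<chi> i. frac (v $ i))"

lemma suspension_eq: "suspension T t (x, r) = (T (floor_vec (t + r)) x, frac_vec (t + r))"
  by (simp add: suspension_def floor_vec_def frac_vec_def)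

lemma frac_vec_in_unit_cube: "frac_vec v \<in> unit_cube"
  by (simp add: unit_cube_def frac_vec_def frac_lt_1)

lemma frac_vec_eq: "frac_vec v = v - int_vec (floor_vec v)"
  by (simp add: frac_vec_def int_vec_def floor_vec_def frac_def vec_eq_iff)

lemma diff_int_vec_in_unit_cube_iff: "v - int_vec k \<in> unit_cube \<longleftrightarrow> k = floor_vec v"
proof -
  have "0 \<le> v $ i - of_int (k $ i) \<and> v $ i - of_int (k $ i) < 1 \<longleftrightarrow> k $ i = \<lfloor>v $ i\<rfloor>" for i
    by linarith
  then show ?thesis
    by (simp add: unit_cube_def int_vec_def floor_vec_def vec_eq_iff)
qed

lemma borel_measurable_vec_nth [measurable]: "(\<lambda>v :: real ^ 'n. v $ i) \<in> borel_measurable borel"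
  by (intro borel_measurable_continuous_onI continuous_intros)

lemma unit_cube_borel [measurable]: "(unit_cube :: (real ^ 'n) set) \<in> sets borel"
proof -
  have "unit_cube = (\<Inter>i. {r :: real ^ 'n. 0 \<le> r $ i} \<inter> {r. r $ i < 1})"
    by (auto simp: unit_cube_def)
  also have "\<dots> \<in> sets borel"
    by (intro sets.countable_INT'' sets.Int) (auto simp: borel_closed borel_open closed_halfspace_component_ge_cart open_halfspace_component_lt_cart)
  finally show ?thesis .
qed

lemma space_cube_measure: "space cube_measure = unit_cube"
  by (simp add: cube_measure_def space_restrict_space)

lemma sets_cube_measure: "A \<in> sets cube_measure \<longleftrightarrow> A \<subseteq> unit_cube \<and> A \<in> sets borel"
  unfolding cube_measure_def by (subst sets_restrict_space_iff) auto

lemma emeasure_cube_measure: "A \<subseteq> unit_cube \<Longrightarrow> emeasure cube_measure A = emeasure lborel A"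
  unfolding cube_measure_def by (rule emeasure_restrict_space) auto

lemma prob_space_cube_measure: "prob_space (cube_measure :: (real ^ 'n) measure)"
proof
  have box: "emeasure lborel (box 0 (1 :: real ^ 'n)) = 1" "emeasure lborel (cbox 0 (1 :: real ^ 'n)) = 1"
  proof -
    have one: "(1 :: real ^ 'n) \<bullet> b = 1" if "b \<in> Basis" for b
      using that by (auto simp: Basis_vec_def inner_axis)
    then have "(\<Prod>b\<in>Basis. (1 - 0 :: real ^ 'n) \<bullet> b) = 1"
      by (intro prod.neutral) simp
    then show "emeasure lborel (box 0 (1 :: real ^ 'n)) = 1" "emeasure lborel (cbox 0 (1 :: real ^ 'n)) = 1"
      using one by (subst emeasure_lborel_box emeasure_lborel_cbox; simp)+
  qed
  have "box 0 1 \<subseteq> (unit_cube :: (real ^ 'n) set)" "(unit_cube :: (real ^ 'n) set) \<subseteq> cbox 0 1"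
    by (auto simp: unit_cube_def mem_box_cart less_imp_le)
  then have "emeasure lborel (box 0 (1 :: real ^ 'n)) \<le> emeasure lborel (unit_cube :: (real ^ 'n) set)"
    "emeasure lborel (unit_cube :: (real ^ 'n) set) \<le> emeasure lborel (cbox 0 (1 :: real ^ 'n))"
    by (auto intro!: emeasure_mono)
  then show "emeasure (cube_measure :: (real ^ 'n) measure) (space cube_measure) = 1"
    unfolding space_cube_measure emeasure_cube_measure[OF order_refl] box by (rule antisym[rotated])
qed

lemma countably_total_cube_measure: "countably_total (cube_measure :: (real ^ 'n) measure)"
proof -
  interpret prob_space "cube_measure :: (real ^ 'n) measure" by (rule prob_space_cube_measure)
  have "(\<lambda>r :: real ^ 'n. r) \<in> borel_measurable cube_measure"
    unfolding cube_measure_def by (rule measurable_restrict_space1) simp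
  then show ?thesis
    by (rule countably_total_if_generated_by_map) (auto simp: sets_cube_measure)
qed

lemma floor_vec_measurable [measurable]:
  "(\<lambda>r :: real ^ 'n. floor_vec (t + r)) \<in> measurable borel (count_space UNIV)"
proof (rule measurable_count_space_eq2_countable[THEN iffD2, rule_format])
  have "(\<lambda>r. floor_vec (t + r)) -` {k} = (\<Inter>i. {r :: real ^ 'n. \<lfloor>t $ i + r $ i\<rfloor> = k $ i})" for k
    by (auto simp: floor_vec_def vec_eq_iff)
  moreover have "(\<Inter>i. {r :: real ^ 'n. \<lfloor>t $ i + r $ i\<rfloor> = k $ i}) \<in> sets borel" for k
    by (intro sets.countable_INT'') (auto intro: borel_measurable_vec_nth)
  ultimately show "(\<lambda>r. floor_vec (t + r)) \<in> space borel \<rightarrow> UNIV \<and>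
      (\<forall>k\<in>UNIV. (\<lambda>r :: real ^ 'n. floor_vec (t + r)) -` {k} \<inter> space borel \<in> sets borel)"
    by simp
qed

lemma frac_vec_measurable [measurable]:
  "(\<lambda>r :: real ^ 'n. frac_vec (t + r)) \<in> borel_measurable borel"
  unfolding frac_vec_eq by (intro borel_measurable_diff measurable_compose[OF floor_vec_measurable]) auto

lemma frac_vec_measurable_cube: "(\<lambda>r. frac_vec (t + r)) \<in> measurable cube_measure cube_measure"
  unfolding cube_measure_def
  by (rule measurable_restrict_space2, rule_tac[2] measurable_restrict_space1)
    (auto simp: frac_vec_in_unit_cube)

text \<open>
  The rotation by \<open>t\<close> is a translation on each of the countably many pieces on which \<open>\<lfloor>t + r\<rfloor>\<close> is
  constant, and the images of the pieces again tile the cube.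
\<close>

lemma emeasure_frac_vec_vimage:
  assumes B: "B \<in> sets (cube_measure :: (real ^ 'n) measure)"
  shows "emeasure cube_measure ((\<lambda>r. frac_vec (t + r)) -` B \<inter> unit_cube) = emeasure cube_measure B"
proof -
  have BC: "B \<subseteq> unit_cube" and [measurable]: "B \<in> sets borel" using B by (auto simp: sets_cube_measure)
  \<comment> \<open>\<open>A k\<close> is the part of the preimage of \<open>B\<close> where \<open>\<lfloor>t + r\<rfloor> = k\<close>, and \<open>C k\<close> is its translate inside \<open>B\<close>.\<close>
  define A where "A k = {r \<in> unit_cube. (t - int_vec k) + r \<in> B}" for k
  define C where "C k = {s \<in> B. s - (t - int_vec k) \<in> unit_cube}" for k
  have A_iff: "r \<in> A k \<longleftrightarrow> r \<in> unit_cube \<and> frac_vec (t + r) \<in> B \<and> k = floor_vec (t + r)" for r k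
  proof -
    have eq: "(t - int_vec k) + r = (t + r) - int_vec k" by (simp add: algebra_simps)
    show ?thesis
      unfolding A_def mem_Collect_eq eq frac_vec_eq[of "t + r"]
      using BC diff_int_vec_in_unit_cube_iff[of "t + r" k] by blast
  qed
  have C_iff: "s \<in> C k \<longleftrightarrow> s \<in> B \<and> k = - floor_vec (s - t)" for s k
  proof -
    have "s - (t - int_vec k) = (s - t) - int_vec (- k)"
      by (simp add: int_vec_def vec_eq_iff)
    then have "s - (t - int_vec k) \<in> unit_cube \<longleftrightarrow> - k = floor_vec (s - t)"
      by (simp only: diff_int_vec_in_unit_cube_iff)
    then show ?thesis
      unfolding C_def mem_Collect_eq equation_minus_iff[of k] by (simp only: eq_commute[of "- k"])
  qed
  have Ck [measurable]: "C k \<in> sets borel" for k unfolding C_def by measurable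
  have Ak: "A k = (+) (t - int_vec k) -` C k" for k by (auto simp: A_def C_def)
  have Am [measurable]: "A k \<in> sets borel" for k
    unfolding A_def by measurable
  have trans: "emeasure lborel (A k) = emeasure lborel (C k)" for k
  proof -
    have "emeasure lborel (C k) = emeasure (distr lborel borel ((+) (t - int_vec k))) (C k)"
      unfolding lborel_distr_plus ..
    also have "\<dots> = emeasure lborel (A k)"
      unfolding Ak by (subst emeasure_distr) auto
    finally show ?thesis ..
  qed
  have disjoint: "disjoint_family A" "disjoint_family C"
    by (auto simp: disjoint_family_on_def A_iff C_iff)
  have UN: "(\<lambda>r. frac_vec (t + r)) -` B \<inter> unit_cube = (\<Union>k. A k)" "B = (\<Union>k. C k)"
    by (auto simp: A_iff C_iff)
  have "emeasure lborel (\<Union>k. A k) = (\<integral>\<^sup>+k. emeasure lborel (A k) \<partial>count_space UNIV)"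
    by (intro emeasure_UN_countable disjoint) auto
  also have "\<dots> = (\<integral>\<^sup>+k. emeasure lborel (C k) \<partial>count_space UNIV)"
    unfolding trans ..
  also have "\<dots> = emeasure lborel (\<Union>k. C k)"
    by (intro emeasure_UN_countable[symmetric] disjoint) auto
  finally have "emeasure lborel ((\<lambda>r. frac_vec (t + r)) -` B \<inter> unit_cube) = emeasure lborel B"
    unfolding UN(1)[symmetric] UN(2)[symmetric] .
  then show ?thesis using BC by (simp add: emeasure_cube_measure)
qed

lemma distr_frac_vec:
  "distr cube_measure cube_measure (\<lambda>r. frac_vec (t + r)) = (cube_measure :: (real ^ 'n) measure)"
proof (rule measure_eqI)
  fix B :: "(real ^ 'n) set" assume "B \<in> sets (distr cube_measure cube_measure (\<lambda>r. frac_vec (t + r)))"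
  then have B: "B \<in> sets (cube_measure :: (real ^ 'n) measure)" by simp
  then show "emeasure (distr cube_measure cube_measure (\<lambda>r. frac_vec (t + r))) B = emeasure cube_measure B"
    using emeasure_distr[OF frac_vec_measurable_cube B, of t] emeasure_frac_vec_vimage[OF B, of t]
    by (simp add: space_cube_measure)
qed simp

section \<open>The unit suspension\<close>

lemma space_susp_measure: "space (susp_measure M) = space M \<times> unit_cube"
  by (simp add: susp_measure_def space_pair_measure space_cube_measure)

lemma prob_space_susp_measure:
  assumes "prob_space M"
  shows "prob_space (susp_measure M :: ('a \<times> (real ^ 'n)) measure)"
proof -
  interpret M: prob_space M by fact
  interpret C: prob_space "cube_measure :: (real ^ 'n) measure" by (rule prob_space_cube_measure)
  interpret P: pair_prob_space M "cube_measure :: (real ^ 'n) measure" ..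
  show ?thesis unfolding susp_measure_def by (rule P.prob_space_axioms)
qed

text \<open>On each of the countably many sets where \<open>\<lfloor>t + r\<rfloor>\<close> is constant, a single \<open>T\<close> acts on the fibre.\<close>

lemma suspension_measurable:
  fixes T :: "int ^ 'n \<Rightarrow> 'a \<Rightarrow> 'a"
  assumes "mp_action M T"
  shows "suspension T t \<in> measurable (susp_measure M) (susp_measure M)"
proof -
  have [measurable]: "T k \<in> measurable M M" for k using assms by (simp add: mp_action_def)
  have floor: "(\<lambda>r. floor_vec (t + r)) \<in> measurable (cube_measure :: (real ^ 'n) measure) (count_space UNIV)"
    unfolding cube_measure_def by (rule measurable_restrict_space1) simp
  have "(\<lambda>y. T (floor_vec (t + snd y)) (fst y)) \<in> measurable (M \<Otimes>\<^sub>M cube_measure) M"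
    by (rule measurable_compose_countable[where f = "\<lambda>k y. T k (fst y)"])
      (auto intro: measurable_compose[OF measurable_snd floor])
  moreover have "(\<lambda>y. frac_vec (t + snd y)) \<in> measurable (M \<Otimes>\<^sub>M cube_measure) cube_measure"
    by (rule measurable_compose[OF measurable_snd frac_vec_measurable_cube])
  moreover have "suspension T t = (\<lambda>y. (T (floor_vec (t + snd y)) (fst y), frac_vec (t + snd y)))"
    by (auto simp: suspension_eq)
  ultimately show ?thesis unfolding susp_measure_def by simp
qed

text \<open>
  On the fibre over \<open>r\<close> the suspension acts by one measure preserving map, so the preimage of \<open>A \<times> B\<close> has
  slices of measure \<open>\<mu> A\<close> over the rotated preimage of \<open>B\<close>, and the rotation preserves the measure of \<open>B\<close>.
\<close>

lemma distr_suspension: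
  fixes T :: "int ^ 'n \<Rightarrow> 'a \<Rightarrow> 'a"
  assumes "prob_space M" and T: "mp_action M T"
  shows "distr (susp_measure M) (susp_measure M) (suspension T t) = susp_measure M"
proof -
  interpret M: prob_space M by fact
  interpret C: prob_space "cube_measure :: (real ^ 'n) measure" by (rule prob_space_cube_measure)
  interpret P: pair_prob_space M "cube_measure :: (real ^ 'n) measure" ..
  let ?D = "distr (susp_measure M) (susp_measure M) (suspension T t)"
  have T_meas: "T k \<in> measurable M M" and T_distr: "distr M M (T k) = M" for k
    using T by (auto simp: mp_action_def)
  have "M \<Otimes>\<^sub>M cube_measure = ?D"
  proof (rule pair_measure_eqI)
    show "sigma_finite_measure M" "sigma_finite_measure (cube_measure :: (real ^ 'n) measure)"
      by unfold_locales
    show "sets (M \<Otimes>\<^sub>M cube_measure) = sets ?D" by (simp add: susp_measure_def)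
    fix A and B :: "(real ^ 'n) set" assume A: "A \<in> sets M" and B: "B \<in> sets cube_measure"
    let ?V = "suspension T t -` (A \<times> B) \<inter> space (susp_measure M)"
    let ?R = "(\<lambda>r. frac_vec (t + r)) -` B \<inter> unit_cube"
    have AB: "A \<times> B \<in> sets (susp_measure M)" using A B by (simp add: susp_measure_def)
    have V: "?V \<in> sets (M \<Otimes>\<^sub>M cube_measure)"
      using measurable_sets[OF suspension_measurable[OF T] AB, of t] by (simp add: susp_measure_def)
    have R: "?R \<in> sets cube_measure"
      using measurable_sets[OF frac_vec_measurable_cube B, of t] by (simp add: space_cube_measure)
    have slice: "emeasure M ((\<lambda>x. (x, r)) -` ?V) = emeasure M A * indicator ?R r" for r
    proof (cases "r \<in> ?R")
      case True
      then have "(\<lambda>x. (x, r)) -` ?V = T (floor_vec (t + r)) -` A \<inter> space M"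
        by (auto simp: space_susp_measure suspension_eq)
      also have "emeasure M \<dots> = emeasure (distr M M (T (floor_vec (t + r)))) A"
        using A T_meas by (simp add: emeasure_distr)
      finally show ?thesis using True by (simp add: T_distr)
    next
      case False
      then have "(\<lambda>x. (x, r)) -` ?V = {}"
        by (auto simp: space_susp_measure suspension_eq)
      then show ?thesis using False by simp
    qed
    have "emeasure ?D (A \<times> B) = emeasure (M \<Otimes>\<^sub>M cube_measure) ?V"
      using emeasure_distr[OF suspension_measurable[OF T] AB, of t] by (simp add: susp_measure_def)
    also have "\<dots> = (\<integral>\<^sup>+r. emeasure M A * indicator ?R r \<partial>cube_measure)"
      unfolding P.emeasure_pair_measure_alt2[OF V] slice ..
    also have "\<dots> = emeasure M A * emeasure cube_measure ?R"
      using R by (rule nn_integral_cmult_indicator)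
    also have "\<dots> = emeasure M A * emeasure cube_measure B"
      unfolding emeasure_frac_vec_vimage[OF B] ..
    finally show "emeasure M A * emeasure cube_measure B = emeasure ?D (A \<times> B)" ..
  qed
  then show ?thesis by (simp add: susp_measure_def)
qed

lemma mp_action_suspension:
  fixes T :: "int ^ 'n \<Rightarrow> 'a \<Rightarrow> 'a"
  assumes "prob_space M" and T: "mp_action M T"
  shows "mp_action (susp_measure M) (suspension T)"
proof -
  have T0: "T 0 x = x" and Tadd: "T (j + k) x = T j (T k x)" if "x \<in> space M" for x j k
    using T that by (auto simp: mp_action_def)
  have "suspension T 0 (x, r) = (x, r)" if "x \<in> space M" "r \<in> unit_cube" for x r
  proof -
    have "int_vec (0 :: int ^ 'n) = 0" by (simp add: int_vec_def vec_eq_iff)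
    then have "floor_vec r = 0"
      using diff_int_vec_in_unit_cube_iff[of r 0] that(2) by simp
    moreover from this have "frac_vec r = r"
      using frac_vec_eq[of r] \<open>int_vec 0 = 0\<close> by simp
    ultimately show ?thesis using that T0 by (simp add: suspension_eq)
  qed
  moreover have "suspension T (s + t) (x, r) = suspension T s (suspension T t (x, r))"
    if "x \<in> space M" for s t x and r :: "real ^ 'n"
  proof -
    \<comment> \<open>The cocycle identity of the floor function.\<close>
    have fl: "floor_vec (s + t + r) = floor_vec (s + frac_vec (t + r)) + floor_vec (t + r)"
      by (simp add: floor_vec_def frac_vec_def vec_eq_iff frac_def add.assoc[symmetric] del: floor_diff_of_int)
        (simp add: diff_add_eq add.assoc add_diff_eq)
    have "int_vec (j + k) = int_vec j + int_vec k" for j k :: "int ^ 'n"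
      by (simp add: int_vec_def vec_eq_iff)
    then have "frac_vec (s + t + r) = frac_vec (s + frac_vec (t + r))"
      unfolding frac_vec_eq[of "s + t + r"] frac_vec_eq[of "s + frac_vec (t + r)"] fl
      using frac_vec_eq[of "t + r"] by simp
    then show ?thesis
      using Tadd[OF that] by (simp add: suspension_eq fl)
  qed
  ultimately show ?thesis
    unfolding mp_action_def using suspension_measurable[OF T] distr_suspension[OF assms]
    by (auto simp: space_susp_measure)
qed

lemma L2_frac_vec:
  assumes "f \<in> L2 cube_measure"
  shows "(\<lambda>r. f (frac_vec (t + r))) \<in> L2 cube_measure"
proof -
  have "integrable (distr cube_measure cube_measure (\<lambda>r. frac_vec (t + r))) (\<lambda>r. (cmod (f r))\<^sup>2)"
    unfolding distr_frac_vec using assms by (rule L2_integrable_normsq)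
  then show ?thesis
    using measurable_compose[OF frac_vec_measurable_cube L2_measurable[OF assms], of t]
      integrable_distr[OF frac_vec_measurable_cube]
    by (auto simp: L2_def)
qed

lemma L2_cube_lift:
  assumes "prob_space M" and f: "f \<in> L2 (cube_measure :: (real ^ 'n) measure)"
  shows "(\<lambda>(x, s). f s) \<in> L2 (susp_measure M)"
proof -
  interpret M: prob_space M by fact
  interpret C: prob_space "cube_measure :: (real ^ 'n) measure" by (rule prob_space_cube_measure)
  interpret P: pair_prob_space M "cube_measure :: (real ^ 'n) measure" ..
  have meas: "(\<lambda>y. f (snd y)) \<in> borel_measurable (M \<Otimes>\<^sub>M cube_measure)"
    by (rule measurable_compose[OF measurable_snd L2_measurable[OF f]])
  then have "(\<lambda>y. (cmod (f (snd y)))\<^sup>2) \<in> borel_measurable (M \<Otimes>\<^sub>M cube_measure)"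
    by measurable
  then have "integrable (M \<Otimes>\<^sub>M cube_measure) (\<lambda>y. (cmod (f (snd y)))\<^sup>2)"
    using L2_integrable_normsq[OF f] by (intro P.Fubini_integrable) auto
  then show ?thesis
    using meas by (simp add: L2_def susp_measure_def case_prod_beta)
qed

lemma L2_O_eq: "L2_O M = l2_perp (susp_measure M) O_space"
  by (simp add: L2_O_def l2_perp_def l2_inner_def)

lemma l2_flow_suspension:
  fixes T :: "int ^ 'n \<Rightarrow> 'a \<Rightarrow> 'a"
  assumes M: "lebesgue_prob_space M" and T: "mp_action M T"
  shows "l2_flow (susp_measure M) (suspension T) O_space"
proof -
  have prob: "prob_space M" using M by (simp add: lebesgue_prob_space_def)
  interpret prob_space "susp_measure M :: ('a \<times> (real ^ 'n)) measure"
    by (rule prob_space_susp_measure[OF prob])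
  show ?thesis
  proof
    show "mp_action (susp_measure M) (suspension T)" by (rule mp_action_suspension[OF prob T])
    show "countably_total (susp_measure M :: ('a \<times> (real ^ 'n)) measure)"
      unfolding susp_measure_def
      by (intro countably_total_pair prob prob_space_cube_measure countably_total_cube_measure
          lebesgue_prob_space_countably_total M)
    show "O_space \<subseteq> L2 (susp_measure M :: ('a \<times> (real ^ 'n)) measure)"
      using L2_cube_lift[OF prob] by (auto simp: O_space_def)
  next
    fix G :: "'a \<times> (real ^ 'n) \<Rightarrow> complex" and t
    assume "G \<in> O_space"
    then obtain f where f: "f \<in> L2 cube_measure" "G = (\<lambda>(x, s). f s)" by (auto simp: O_space_def)
    then have "(\<lambda>y. G (suspension T t y)) = (\<lambda>(x, s). f (frac_vec (t + s)))"
      by (auto simp: suspension_eq)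
    then show "(\<lambda>y. G (suspension T t y)) \<in> O_space"
      using L2_frac_vec[OF f(1), of t] by (auto simp: O_space_def)
  qed
qed

theorem theorem5p5:
  fixes M :: "'a measure"
  assumes "lebesgue_prob_space M"
  shows "(\<forall>T :: real ^ 'n \<Rightarrow> 'a \<Rightarrow> 'a. rd_action M T \<and> ergodic_on M T UNIV \<longrightarrow>
            (\<exists>!NE. structure_set (rd_ergodic_dirs M T) NE) \<and>
            (\<exists>!NW. structure_set (rd_weak_mixing_dirs M T) NW)) \<and>
         (\<forall>T :: int ^ 'n \<Rightarrow> 'a \<Rightarrow> 'a. zd_action M T \<and> ergodic_on M T UNIV \<longrightarrow>
            (\<exists>!NE. structure_set (zd_ergodic_dirs M T) NE) \<and>
            (\<exists>!NW. structure_set (zd_weak_mixing_dirs M T) NW))"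
proof (rule conjI; intro allI impI; elim conjE)
  fix T :: "real ^ 'n \<Rightarrow> 'a \<Rightarrow> 'a" assume "rd_action M T"
  then have "mp_action M T" by (simp add: rd_action_def)
  then interpret mean_zero_flow M T
    using l2_flow_constants[OF assms] by (simp add: mean_zero_flow_def)
  show "(\<exists>!NE. structure_set (rd_ergodic_dirs M T) NE) \<and> (\<exists>!NW. structure_set (rd_weak_mixing_dirs M T) NW)"
    unfolding ergodic_dirs_eq weak_mixing_dirs_eq
    by (intro conjI ex1_structure_set_eigenfunction frequency_family_zero frequency_family_id)
next
  fix T :: "int ^ 'n \<Rightarrow> 'a \<Rightarrow> 'a" assume "zd_action M T"
  then have "mp_action M T" by (simp add: zd_action_def)
  then interpret l2_flow "susp_measure M" "suspension T" O_space
    by (rule l2_flow_suspension[OF assms])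
  have "zd_ergodic_dirs M T = {L \<in> directions. \<not> has_eigenfunction (\<lambda>_. {0}) L}"
    by (simp add: zd_ergodic_dirs_def dir_invariant_def has_eigenfunction_iff L2_O_eq)
  moreover have "zd_weak_mixing_dirs M T = {L \<in> directions. \<not> has_eigenfunction (\<lambda>L. L) L}"
    by (simp add: zd_weak_mixing_dirs_def dir_eigenfunction_def has_eigenfunction_iff L2_O_eq)
  ultimately show "(\<exists>!NE. structure_set (zd_ergodic_dirs M T) NE) \<and> (\<exists>!NW. structure_set (zd_weak_mixing_dirs M T) NW)"
    using ex1_structure_set_eigenfunction[OF frequency_family_zero]
      ex1_structure_set_eigenfunction[OF frequency_family_id] by simp
qed

end
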